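(* Under the heavy-tailed assumption stated in the context, for any $0<\epsilon\le1$ the instance-dependent expected regret of the DP Robust Upper Confidence Bound algorithm (defined in the context), with horizon $T$ and parameters $\epsilon,v,u$, satisfies $$\mathcal R_T\le O\left(\sum_{a:\Delta_a>0}\left(\frac{\log^{2.5+\frac1v}T}{\epsilon}\Bigl(\frac u{\Delta_a}\Bigr)^{\frac1v}+\Delta_a\right)\right).$$
   Context: Bandit setting. There are $K$ arms and $T$ rounds. Pulling arm $a$ yields an independent reward from an unknown distribution $\mathcal X_a$ on $\mathbb R$ with mean $\mu_a$. In each round $t=1,\dots,T$ the learner pulls an arm $a_t\in[K]$ and observes a reward $x_t\sim\mathcal X_{a_t}$. Heavy-tailed assumption: for some $v\in(0,1]$ and $u>0$, $\mathbb E_{X\sim\mathcal X_a}[|X|^{1+v}]\le u$ for every arm $a$. Both $v$ and $u$ are known constants (for any constant $c$, $c^{1/v}$ is regarded as a constant), and $O(\cdot)$ hides constant factors. Let $\mu^*=\max_a\mu_a$ and $\Delta_a=\mu^*-\mu_a$. The expected regret is $\mathcal R_T=T\mu^*-\mathbb E[\sum_{t=1}^Tx_t]$. $\mathrm{Lap}(\lambda)$ is the Laplace distribution with density $\frac1{2\lambda}e^{-|x|/\lambda}$. The base of $\log$ is not specified. (Adaptive) Tree-based mechanism (horizon $T$, budget $\epsilon$, a stream $y_1,y_2,\dots$ with $|y_n|\le B_n$ and $B_n$ non-decreasing). Let $\epsilon'=\epsilon/\log T$. Initialize $\alpha_i=\widehat\alpha_i=0$ for all $i\ge0$. When the $n$-th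 item $y_n$ arrives: - Write $n=\sum_j\mathrm{Bin}_j(n)2^j$ in binary and let $i=\min\{j:\mathrm{Bin}_j(n)\ne0\}$. - Set $\alpha_i\leftarrow\sum_{j<i}\alpha_j+y_n$. - Set $\alpha_j\leftarrow0$ and $\widehat\alpha_j\leftarrow0$ for $j=0,\dots,i-1$. - Set $\widehat\alpha_i\leftarrow\alpha_i+\mathrm{Lap}(2B_n/\epsilon')$ with fresh independent noise. - The current output is $\widehat S=\sum_{j:\mathrm{Bin}_j(n)=1}\widehat\alpha_j$. DP Robust Upper Confidence Bound (horizon $T$, parameters $\epsilon,v,u$). Put $B_n=\left(\frac{\epsilon un}{\log^{1.5}T}\right)^{1/(1+v)}$ for $n\in\mathbb N^+$. Keep one tree mechanism per arm and a pull counter $n_a$ (initially $0$) for each arm. In rounds $t=1,\dots,K$ pull arm $t$. In rounds $t=K+1,\dots,T$ pull the arm $$a_t=\arg\max_a\ \frac{\widehat S_a(t)}{n_a}+18u^{\frac1{1+v}}\left(\frac{\log(2t^4)\log^{1.5+\frac1v}T}{n_a\epsilon}\right)^{\frac v{1+v}},$$ where $\widehat S_a(t)$ is the current output of arm $a$'s tree. After each pull of an arm $a$ with reward $x$, increase $n_a$ by one, truncate to $\widetilde x=x\,\mathbb I_{|x|\le B_{n_a}}$, and insert $\widetilde x$ into arm $a$'s tree (as its $n_a$-th item). *)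

theory Defs
  imports "HOL-Probability.Probability"
begin

definition laplace :: "real \<Rightarrow> real measure" where
  "laplace s = density lborel (\<lambda>x. ennreal (exp (- \<bar>x\<bar> / s) / (2 * s)))"

definition heavy_tailed :: "real \<Rightarrow> real \<Rightarrow> real measure \<Rightarrow> bool" where
  "heavy_tailed v u D \<longleftrightarrow>
     real_distribution D \<and>
     integrable D (\<lambda>x. \<bar>x\<bar> powr (1 + v)) \<and>
     (\<integral>x. \<bar>x\<bar> powr (1 + v) \<partial>D) \<le> u"


section \<open>Tree-based mechanism\<close>

text \<open>
  A state is the pair of node families \<open>(\<alpha>, \<alpha>h)\<close>: exact and noisy partial sums.
  The item \<open>y\<close> is the \<open>n\<close>-th one (\<open>n \<ge> 1\<close>); \<open>z\<close> is the single fresh noise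
  variable that its arrival requires.
\<close>

type_synonym tree_state = "(nat \<Rightarrow> real) \<times> (nat \<Rightarrow> real)"

definition tree_step :: "nat \<Rightarrow> real \<Rightarrow> real \<Rightarrow> tree_state \<Rightarrow> tree_state" where
  "tree_step n y z = (\<lambda>(\<alpha>, \<alpha>h).
     let i = (LEAST j. bit n j);
         s = (\<Sum>j<i. \<alpha> j) + y
     in (\<lambda>j. if j < i then 0 else if j = i then s else \<alpha> j,
         \<lambda>j. if j < i then 0 else if j = i then s + z else \<alpha>h j))"

primrec tree_run :: "(nat \<Rightarrow> real) \<Rightarrow> (nat \<Rightarrow> real) \<Rightarrow> nat \<Rightarrow> tree_state" where
  "tree_run y z 0 = (\<lambda>_. 0, \<lambda>_. 0)"
| "tree_run y z (Suc n) = tree_step (Suc n) (y (Suc n)) (z (Suc n)) (tree_run y z n)"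

definition tree_output :: "(nat \<Rightarrow> real) \<Rightarrow> (nat \<Rightarrow> real) \<Rightarrow> nat \<Rightarrow> real" where
  "tree_output y z n = (\<Sum>j | bit n j. snd (tree_run y z n) j)"


section \<open>DP Robust Upper Confidence Bound\<close>

text \<open>
  Throughout, \<open>b\<close> is the base of the logarithm, \<open>T\<close> the horizon, and the arms are \<open>{1..K}\<close>.
\<close>

definition trunc_level :: "real \<Rightarrow> real \<Rightarrow> real \<Rightarrow> real \<Rightarrow> nat \<Rightarrow> nat \<Rightarrow> real" where
  "trunc_level b \<epsilon> v u T n =
     (\<epsilon> * u * real n / log b (real T) powr 1.5) powr (1 / (1 + v))"

definition noise_scale :: "real \<Rightarrow> real \<Rightarrow> real \<Rightarrow> real \<Rightarrow> nat \<Rightarrow> nat \<Rightarrow> real" where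
  "noise_scale b \<epsilon> v u T n = 2 * trunc_level b \<epsilon> v u T n / (\<epsilon> / log b (real T))"

text \<open>
  All randomness is put into one table of independent entries. The entry at \<open>(a, n)\<close>
  consists of the reward returned by the \<open>n\<close>-th pull of arm \<open>a\<close> and of the noise that is
  drawn when this reward is inserted into the tree of arm \<open>a\<close>. Within \<open>T\<close> rounds no arm
  is pulled more than \<open>T\<close> times.
\<close>

type_synonym table = "nat \<times> nat \<Rightarrow> real \<times> real"

definition table_measure ::
  "real \<Rightarrow> real \<Rightarrow> real \<Rightarrow> real \<Rightarrow> nat \<Rightarrow> nat \<Rightarrow> (nat \<Rightarrow> real measure) \<Rightarrow> table measure" where
  "table_measure b \<epsilon> v u K T D =
     (\<Pi>\<^sub>M (a, n) \<in> {1..K} \<times> {1..T}. D a \<Otimes>\<^sub>M laplace (noise_scale b \<epsilon> v u T n))"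

definition arm_stream ::
  "real \<Rightarrow> real \<Rightarrow> real \<Rightarrow> real \<Rightarrow> nat \<Rightarrow> table \<Rightarrow> nat \<Rightarrow> nat \<Rightarrow> real" where
  "arm_stream b \<epsilon> v u T \<omega> a n =
     (let x = fst (\<omega> (a, n)) in if \<bar>x\<bar> \<le> trunc_level b \<epsilon> v u T n then x else 0)"

definition private_sum ::
  "real \<Rightarrow> real \<Rightarrow> real \<Rightarrow> real \<Rightarrow> nat \<Rightarrow> table \<Rightarrow> nat \<Rightarrow> nat \<Rightarrow> real" where
  "private_sum b \<epsilon> v u T \<omega> a n =
     tree_output (arm_stream b \<epsilon> v u T \<omega> a) (\<lambda>m. snd (\<omega> (a, m))) n"

definition ucb_index ::
  "real \<Rightarrow> real \<Rightarrow> real \<Rightarrow> real \<Rightarrow> nat \<Rightarrow> table \<Rightarrow> nat \<Rightarrow> (nat \<Rightarrow> nat) \<Rightarrow> nat \<Rightarrow> real" where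
  "ucb_index b \<epsilon> v u T \<omega> t N a =
     private_sum b \<epsilon> v u T \<omega> a (N a) / real (N a)
     + 18 * u powr (1 / (1 + v))
       * (log b (2 * real t ^ 4) * log b (real T) powr (1.5 + 1 / v) / (real (N a) * \<epsilon>))
           powr (v / (1 + v))"

text \<open>
  The maximizer in round \<open>t\<close> need not be unique: \<open>tie t S\<close> is the arm picked from the set \<open>S\<close>
  of maximizers.
\<close>

definition tie_rule :: "nat \<Rightarrow> (nat \<Rightarrow> nat set \<Rightarrow> nat) \<Rightarrow> bool" where
  "tie_rule K tie \<longleftrightarrow> (\<forall>t S. S \<subseteq> {1..K} \<and> S \<noteq> {} \<longrightarrow> tie t S \<in> S)"

text \<open>Arm pulled in round \<open>t\<close>, given the pull counters \<open>N\<close> before that round.\<close>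

definition choose_arm ::
  "real \<Rightarrow> real \<Rightarrow> real \<Rightarrow> real \<Rightarrow> nat \<Rightarrow> nat \<Rightarrow> (nat \<Rightarrow> nat set \<Rightarrow> nat) \<Rightarrow> table
    \<Rightarrow> nat \<Rightarrow> (nat \<Rightarrow> nat) \<Rightarrow> nat" where
  "choose_arm b \<epsilon> v u K T tie \<omega> t N =
     (if t \<le> K then t
      else tie t {a. is_arg_max (ucb_index b \<epsilon> v u T \<omega> t N) (\<lambda>a. a \<in> {1..K}) a})"

text \<open>Pull counters after \<open>t\<close> rounds.\<close>

primrec pulls ::
  "real \<Rightarrow> real \<Rightarrow> real \<Rightarrow> real \<Rightarrow> nat \<Rightarrow> nat \<Rightarrow> (nat \<Rightarrow> nat set \<Rightarrow> nat) \<Rightarrow> table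
    \<Rightarrow> nat \<Rightarrow> nat \<Rightarrow> nat" where
  "pulls b \<epsilon> v u K T tie \<omega> 0 = (\<lambda>_. 0)"
| "pulls b \<epsilon> v u K T tie \<omega> (Suc t) =
     (let N = pulls b \<epsilon> v u K T tie \<omega> t;
          a = choose_arm b \<epsilon> v u K T tie \<omega> (Suc t) N
      in N(a := N a + 1))"

definition arm_at ::
  "real \<Rightarrow> real \<Rightarrow> real \<Rightarrow> real \<Rightarrow> nat \<Rightarrow> nat \<Rightarrow> (nat \<Rightarrow> nat set \<Rightarrow> nat) \<Rightarrow> table
    \<Rightarrow> nat \<Rightarrow> nat" where
  "arm_at b \<epsilon> v u K T tie \<omega> t =
     choose_arm b \<epsilon> v u K T tie \<omega> t (pulls b \<epsilon> v u K T tie \<omega> (t - 1))"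

definition reward_at ::
  "real \<Rightarrow> real \<Rightarrow> real \<Rightarrow> real \<Rightarrow> nat \<Rightarrow> nat \<Rightarrow> (nat \<Rightarrow> nat set \<Rightarrow> nat) \<Rightarrow> table
    \<Rightarrow> nat \<Rightarrow> real" where
  "reward_at b \<epsilon> v u K T tie \<omega> t =
     (let a = arm_at b \<epsilon> v u K T tie \<omega> t
      in fst (\<omega> (a, pulls b \<epsilon> v u K T tie \<omega> t a)))"


section \<open>Regret\<close>

definition best_mean :: "nat \<Rightarrow> (nat \<Rightarrow> real measure) \<Rightarrow> real" where
  "best_mean K D = Max ((\<lambda>a. \<integral>x. x \<partial>D a) ` {1..K})"

definition gap :: "nat \<Rightarrow> (nat \<Rightarrow> real measure) \<Rightarrow> nat \<Rightarrow> real" where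
  "gap K D a = best_mean K D - (\<integral>x. x \<partial>D a)"

definition expected_regret ::
  "real \<Rightarrow> real \<Rightarrow> real \<Rightarrow> real \<Rightarrow> nat \<Rightarrow> nat \<Rightarrow> (nat \<Rightarrow> nat set \<Rightarrow> nat)
    \<Rightarrow> (nat \<Rightarrow> real measure) \<Rightarrow> real" where
  "expected_regret b \<epsilon> v u K T tie D =
     real T * best_mean K D
     - (\<integral>\<omega>. (\<Sum>t = 1..T. reward_at b \<epsilon> v u K T tie \<omega> t) \<partial>table_measure b \<epsilon> v u K T D)"

end

theory Submission
  imports Defs
begin

text \<open>
  The output of the tree after \<open>n\<close> items is their sum plus at most \<open>log 2 n + 1\<close> independent
  Laplace variables of scale at most \<open>s n\<close>. A Chernoff bound with the single parameter
  \<open>1 / (s n * w)\<close>, \<open>w = L powr (1/4)\<close>, \<open>L = log b T\<close>, shows that it deviates from its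
  mean by more than \<open>n\<close> times the confidence width with probability at most \<open>1 / (2 t\<^sup>4)\<close>,
  provided that \<open>L\<close> exceeds a threshold depending on \<open>b\<close>. Below that threshold
  \<open>T\<close> is bounded and the regret is at most \<open>T\<close> times the sum of the gaps. Above it the usual UCB
  argument applies: outside the failure events an arm \<open>a\<close> is pulled in round \<open>t > K\<close> only if its gap
  is at most twice its width, which bounds its number of pulls. The regret equals the
  sum of \<open>gap a * E N\<^sub>a(T)\<close> because \<open>N\<^sub>a(T) \<ge> n\<close> is independent of the \<open>n\<close>-th reward of \<open>a\<close>.
\<close>

section \<open>Output of the tree\<close>

text \<open>All bits below the lowest set bit vanish, so the corresponding power of two divides
  \<open>n\<close>; the set bit itself makes the quotient odd.\<close>

lemma lowest_bit_decomp:
  fixes n :: nat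
  assumes "0 < n"
  obtains q where "n = 2 ^ (LEAST j. bit n j) * (2 * q + 1)"
proof -
  let ?i = "LEAST j. bit n j"
  have ex: "\<exists>j. bit n j"
    using assms by (metis bit_eq_iff bit_0_eq bot_apply bot_bool_def less_irrefl)
  have bi: "bit n ?i" using ex by (rule LeastI_ex)
  have "take_bit ?i n = 0"
    by (rule bit_eqI) (auto simp: bit_take_bit_iff dest: not_less_Least)
  then have dv: "2 ^ ?i dvd n" by (simp add: take_bit_eq_mod mod_eq_0_iff_dvd)
  have "odd (n div 2 ^ ?i)" using bi by (simp add: bit_iff_odd)
  then obtain q where "n div 2 ^ ?i = 2 * q + 1" by (elim oddE)
  then have "n = 2 ^ ?i * (2 * q + 1)" using dv by (metis dvd_mult_div_cancel)
  then show ?thesis by (rule that)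
qed

text \<open>Incrementing \<open>n\<close> flips its \<open>i\<close> trailing ones, since
  \<open>n = 2 ^ i * (2 * q) + (2 ^ i - 1)\<close>, and no carry goes beyond position
  \<open>i\<close>. The last fact says that nodes above \<open>i\<close> keep the index of the item
  that last wrote them.\<close>

lemma tree_bit_facts:
  fixes n :: nat
  assumes i: "i = (LEAST j. bit (Suc n) j)"
  shows "j < i \<Longrightarrow> \<not> bit (Suc n) j"
    and "bit (Suc n) i" and "\<not> bit n i" and "Suc n mod 2 ^ i = 0"
    and "i < j \<Longrightarrow> bit (Suc n) j = bit n j"
    and "i < j \<Longrightarrow> Suc n - Suc n mod 2 ^ j = n - n mod 2 ^ j"
proof -
  obtain q where q: "Suc n = 2 ^ i * (2 * q + 1)"
    unfolding i using lowest_bit_decomp[of "Suc n"] by blast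
  show "j < i \<Longrightarrow> \<not> bit (Suc n) j" unfolding i by (rule not_less_Least)
  have "Suc n div 2 ^ i = 2 * q + 1" unfolding q by simp
  then show "bit (Suc n) i" by (simp add: bit_iff_odd)
  have n: "n = (2 ^ i - 1) + (2 * q) * 2 ^ i"
    using q by (simp add: algebra_simps)
  have "n div 2 ^ i = 2 * q" unfolding n by (subst div_mult_self1) auto
  then show "\<not> bit n i" by (simp add: bit_iff_odd)
  show md: "Suc n mod 2 ^ i = 0" unfolding q by simp
  show "bit (Suc n) j = bit n j" "Suc n - Suc n mod 2 ^ j = n - n mod 2 ^ j" if "i < j"
  proof -
    have "\<not> 2 ^ j dvd Suc n"
    proof
      assume "2 ^ j dvd Suc n"
      then have "2 ^ Suc i dvd Suc n" using that by (meson dvd_trans le_imp_power_dvd Suc_leI)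
      then have "2 ^ i * 2 dvd 2 ^ i * (2 * q + 1)" by (simp only: q power_Suc2)
      then have "2 dvd 2 * q + 1" by (subst (asm) dvd_times_left_cancel_iff) simp_all
      then show False by simp
    qed
    then have "Suc n div 2 ^ j = n div 2 ^ j" by (simp add: div_Suc dvd_eq_mod_eq_0)
    then show "bit (Suc n) j = bit n j" "Suc n - Suc n mod 2 ^ j = n - n mod 2 ^ j"
      by (simp_all add: bit_iff_odd minus_mod_eq_mult_div)
  qed
qed

lemma bit_nat_less:
  assumes "bit (n::nat) j" shows "2 ^ j \<le> n"
  using assms by (metis bit_iff_odd div_less even_zero not_less)

lemma bit_nat_lessD: "bit (n::nat) j \<Longrightarrow> j < n"
  using bit_nat_less[of n j] by (meson less_le_trans less_exp)

lemma finite_bits: "finite {j. bit (n::nat) j}"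
  by (rule finite_subset[of _ "{..<n}"]) (auto dest: bit_nat_lessD)

text \<open>The first conjunct makes the sum over all \<open>j < i\<close> in
  \<open>tree_step\<close> equal to the sum over the set bits of \<open>n\<close> below
  \<open>i\<close>, so merging these nodes and the new item into node \<open>i\<close> yields the
  right total. Nodes above \<open>i\<close> are left alone and keep their noise.\<close>

lemma tree_run_invariant:
  fixes y z :: "nat \<Rightarrow> real"
  shows "(\<forall>j. \<not> bit n j \<longrightarrow> fst (tree_run y z n) j = 0)
    \<and> (\<Sum>j | bit n j. fst (tree_run y z n) j) = (\<Sum>i = 1..n. y i)
    \<and> (\<forall>j. bit n j \<longrightarrow> snd (tree_run y z n) j = fst (tree_run y z n) j + z (n - n mod 2 ^ j))"
proof (induction n)
  case 0
  then show ?case by simp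
next
  case (Suc n)
  define i where "i = (LEAST j. bit (Suc n) j)"
  note bits = tree_bit_facts[OF i_def]
  obtain \<alpha> \<alpha>h where st: "tree_run y z n = (\<alpha>, \<alpha>h)" by fastforce
  define s where "s = (\<Sum>j<i. \<alpha> j) + y (Suc n)"
  have run: "tree_run y z (Suc n) =
      (\<lambda>j. if j < i then 0 else if j = i then s else \<alpha> j,
       \<lambda>j. if j < i then 0 else if j = i then s + z (Suc n) else \<alpha>h j)"
    by (simp only: tree_run.simps st tree_step_def Let_def split_conv i_def s_def)
  have zero: "\<And>j. \<not> bit n j \<Longrightarrow> \<alpha> j = 0"
    and total: "(\<Sum>j | bit n j. \<alpha> j) = (\<Sum>i = 1..n. y i)"
    and noisy: "\<And>j. bit n j \<Longrightarrow> \<alpha>h j = \<alpha> j + z (n - n mod 2 ^ j)"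
    using Suc.IH by (auto simp: st)
  let ?H = "{j. i < j \<and> bit n j}"
  have fin: "finite ?H" by (rule finite_subset[OF _ finite_bits[of n]]) auto
  have new: "{j. bit (Suc n) j} = insert i ?H"
  proof (rule set_eqI)
    fix j show "j \<in> {j. bit (Suc n) j} \<longleftrightarrow> j \<in> insert i ?H"
      using bits by (cases j i rule: linorder_cases) auto
  qed
  have old: "{j. bit n j} = {j. j < i \<and> bit n j} \<union> ?H"
  proof (rule set_eqI)
    fix j show "j \<in> {j. bit n j} \<longleftrightarrow> j \<in> {j. j < i \<and> bit n j} \<union> ?H"
      using bits(3) by (cases j i rule: linorder_cases) auto
  qed
  have "(\<Sum>j | bit n j. \<alpha> j) = (\<Sum>j | j < i \<and> bit n j. \<alpha> j) + sum \<alpha> ?H"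
    unfolding old by (rule sum.union_disjoint) (use fin in auto)
  also have "(\<Sum>j | j < i \<and> bit n j. \<alpha> j) = (\<Sum>j<i. \<alpha> j)"
    by (rule sum.mono_neutral_left) (auto simp: zero)
  finally have "s + sum \<alpha> ?H = (\<Sum>i = 1..Suc n. y i)"
    using total by (simp add: s_def)
  moreover have "(\<Sum>j | bit (Suc n) j. fst (tree_run y z (Suc n)) j) = s + sum \<alpha> ?H"
    unfolding new run using fin by (simp add: sum.insert)
  ultimately have "(\<Sum>j | bit (Suc n) j. fst (tree_run y z (Suc n)) j) = (\<Sum>i = 1..Suc n. y i)"
    by simp
  moreover have "fst (tree_run y z (Suc n)) j = 0" if "\<not> bit (Suc n) j" for j
    unfolding run using that bits zero by (cases j i rule: linorder_cases) auto
  moreover have "snd (tree_run y z (Suc n)) j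
      = fst (tree_run y z (Suc n)) j + z (Suc n - Suc n mod 2 ^ j)" if "bit (Suc n) j" for j
  proof (cases "j = i")
    case True
    then show ?thesis unfolding run using bits(4) by simp
  next
    case False
    then have "i < j" using that bits(1) by (metis linorder_neqE_nat)
    then show ?thesis unfolding run using bits(5,6)[OF \<open>i < j\<close>] noisy[of j] that by simp
  qed
  ultimately show ?case by blast
qed

text \<open>The item at which node \<open>j\<close> was last written is \<open>n\<close> with its bits below \<open>j\<close> cleared.\<close>

definition noise_items :: "nat \<Rightarrow> nat set" where
  "noise_items n = (\<lambda>j. n - n mod 2 ^ j) ` {j. bit n j}"

text \<open>Clearing the bits below a set bit \<open>j\<close> leaves an odd multiple of
  \<open>2 ^ j\<close>, whereas clearing those below some \<open>k > j\<close> leaves a multiple of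
  \<open>2 ^ Suc j\<close>. Hence distinct active nodes carry distinct, and therefore independent,
  noise variables.\<close>

lemma inj_on_noise_items: "inj_on (\<lambda>j. n - n mod 2 ^ j) {j. bit (n::nat) j}"
proof -
  have "n - n mod 2 ^ j \<noteq> n - n mod 2 ^ k" if "bit n j" "j < k" for j k
  proof
    assume eq: "n - n mod 2 ^ j = n - n mod 2 ^ k"
    have "2 ^ Suc j dvd (2::nat) ^ k" using that(2) by (intro le_imp_power_dvd) simp
    then have "2 ^ Suc j dvd n - n mod 2 ^ k" by (meson dvd_minus_mod dvd_trans)
    then have "2 ^ j * 2 dvd 2 ^ j * (n div 2 ^ j)"
      unfolding eq[symmetric] by (simp add: minus_mod_eq_mult_div mult.commute)
    then show False using that(1) by (simp add: bit_iff_odd)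
  qed
  then show ?thesis unfolding inj_on_def by (metis (mono_tags) linorder_neqE_nat mem_Collect_eq)
qed

lemma tree_output_eq:
  "tree_output y z n = (\<Sum>i = 1..n. y i) + (\<Sum>m\<in>noise_items n. z m)"
  unfolding tree_output_def noise_items_def sum.reindex[OF inj_on_noise_items] comp_def
  using tree_run_invariant[of n y z] by (simp add: sum.distrib)

lemma noise_items_subset: "noise_items n \<subseteq> {1..n}"
proof -
  have "0 < n - n mod 2 ^ j" if "bit n j" for j
    using bit_nat_less[OF that] by (simp add: order.strict_trans2[OF mod_less_divisor])
  then show ?thesis by (fastforce simp: noise_items_def)
qed

lemma card_noise_items:
  assumes "0 < n" shows "real (card (noise_items n)) \<le> log 2 (real n) + 1"
proof -
  have "{j. bit n j} \<subseteq> {..nat \<lfloor>log 2 (real n)\<rfloor>}"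
  proof
    fix j assume "j \<in> {j. bit n j}"
    then have "2 ^ j \<le> n" by (simp add: bit_nat_less)
    then have "(2::real) ^ j \<le> real n" by (metis numeral_power_le_of_nat_cancel_iff)
    then have "real j \<le> log 2 (real n)" using assms by (simp add: le_log_iff powr_realpow)
    then show "j \<in> {..nat \<lfloor>log 2 (real n)\<rfloor>}" by (simp add: le_nat_floor)
  qed
  from card_mono[OF _ this] have "card {j. bit n j} \<le> nat \<lfloor>log 2 (real n)\<rfloor> + 1" by simp
  then have "card (noise_items n) \<le> nat \<lfloor>log 2 (real n)\<rfloor> + 1"
    unfolding noise_items_def card_image[OF inj_on_noise_items] .
  then show ?thesis
    using assms zero_le_log_cancel_iff[of 2 "real n"] by linarith
qed

section \<open>Moment generating functions and product measures\<close>

lemma sets_laplace [measurable_cong, simp]: "sets (laplace s) = sets borel"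
  by (simp add: laplace_def)

lemma space_laplace [simp]: "space (laplace s) = UNIV"
  by (simp add: laplace_def)

lemma nn_integral_exp_Ici:
  fixes c :: real
  assumes "0 < c"
  shows "(\<integral>\<^sup>+x. ennreal (exp (- c * x)) * indicator {0..} x \<partial>lborel) = ennreal (1 / c)"
proof -
  have "filterlim (\<lambda>x. - c * x) at_bot at_top"
    using assms by (intro filterlim_tendsto_neg_mult_at_bot[OF tendsto_const] filterlim_ident) auto
  then have "((\<lambda>x. - exp (- c * x) / c) \<longlongrightarrow> - 0 / c) at_top"
    by (intro tendsto_intros filterlim_compose[OF exp_at_bot]) (use assms in auto)
  then have "((\<lambda>x. - exp (- c * x) / c) \<longlongrightarrow> 0) at_top" by simp
  then have "(\<integral>\<^sup>+x. ennreal (exp (- c * x)) * indicator {0..} x \<partial>lborel)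
      = ennreal (0 - (- exp (- c * 0) / c))"
    by (intro nn_integral_FTC_atLeast)
       (use assms in \<open>auto intro!: derivative_eq_intros simp: field_simps\<close>)
  then show ?thesis by simp
qed

text \<open>The integral splits at 0 into two exponential integrals with rates
  \<open>1 / s - l\<close> and \<open>1 / s + l\<close>; the bound on \<open>l\<close> makes both
  rates positive.\<close>

lemma nn_integral_exp_laplace:
  assumes s: "0 < s" and l: "\<bar>l\<bar> * s < 1"
  shows "(\<integral>\<^sup>+x. ennreal (exp (l * x)) \<partial>laplace s) = ennreal (1 / (1 - l\<^sup>2 * s\<^sup>2))"
proof -
  have pos: "0 < 1 / s - l" "0 < 1 / s + l"
  proof -
    have "\<bar>l * s\<bar> < 1" using l s by (simp add: abs_mult)
    then show "0 < 1 / s - l" "0 < 1 / s + l" using s by (auto simp: field_simps abs_less_iff)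
  qed
  \<comment> \<open>The nonnegative half-line already contains 0, so the reflected half must be
    open.\<close>
  have half: "(\<integral>\<^sup>+x. ennreal (exp (- c * x)) * indicator {0<..} x \<partial>lborel) = ennreal (1 / c)"
    if "0 < c" for c :: real
    unfolding nn_integral_exp_Ici[OF that, symmetric]
    by (rule nn_integral_cong_AE, rule AE_I[where N = "{0}"]) (auto split: split_indicator)
  have "(\<integral>\<^sup>+x. ennreal (exp (l * x)) \<partial>laplace s)
      = (\<integral>\<^sup>+x. ennreal (exp (- \<bar>x\<bar> / s) / (2 * s)) * ennreal (exp (l * x)) \<partial>lborel)"
    unfolding laplace_def by (subst nn_integral_density) auto
  also have "\<dots> = (\<integral>\<^sup>+x. ennreal (1 / (2 * s)) * (ennreal (exp (- (1 / s - l) * x)) * indicator {0..} x)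
      + ennreal (1 / (2 * s)) * (ennreal (exp (- (1 / s + l) * - x)) * indicator {0<..} (- x)) \<partial>lborel)"
    using s by (intro nn_integral_cong)
      (auto split: split_indicator simp: ennreal_mult[symmetric] exp_add[symmetric] field_simps abs_if)
  also have "\<dots> = ennreal (1 / (2 * s)) * (\<integral>\<^sup>+x. ennreal (exp (- (1 / s - l) * x)) * indicator {0..} x \<partial>lborel)
      + ennreal (1 / (2 * s)) * (\<integral>\<^sup>+x. ennreal (exp (- (1 / s + l) * - x)) * indicator {0<..} (- x) \<partial>lborel)"
    by (simp add: nn_integral_add nn_integral_cmult)
  also have "(\<integral>\<^sup>+x. ennreal (exp (- (1 / s + l) * - x)) * indicator {0<..} (- x) \<partial>lborel)
      = (\<integral>\<^sup>+x. ennreal (exp (- (1 / s + l) * x)) * indicator {0<..} x \<partial>lborel)"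
    by (subst (2) nn_integral_real_affine[where c = "-1" and t = 0]) auto
  also have "ennreal (1 / (2 * s)) * (\<integral>\<^sup>+x. ennreal (exp (- (1 / s - l) * x)) * indicator {0..} x \<partial>lborel)
      + ennreal (1 / (2 * s)) * (\<integral>\<^sup>+x. ennreal (exp (- (1 / s + l) * x)) * indicator {0<..} x \<partial>lborel)
      = ennreal (1 / (2 * s) * (1 / (1 / s - l)) + 1 / (2 * s) * (1 / (1 / s + l)))"
    unfolding nn_integral_exp_Ici[OF pos(1)] half[OF pos(2)]
    using s pos by (subst ennreal_plus) (auto simp flip: ennreal_mult)
  also have "1 / (2 * s) * (1 / (1 / s - l)) + 1 / (2 * s) * (1 / (1 / s + l)) = 1 / (1 - l\<^sup>2 * s\<^sup>2)"
  proof -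
    have nz: "1 - l * s \<noteq> 0" "1 + l * s \<noteq> 0" using pos s by (auto simp: field_simps)
    have e: "1 / (1 / s - l) = s / (1 - l * s)" "1 / (1 / s + l) = s / (1 + l * s)"
      using s by (auto simp: field_simps)
    have d: "1 - l\<^sup>2 * s\<^sup>2 = (1 - l * s) * (1 + l * s)" by (simp add: algebra_simps power2_eq_square)
    show ?thesis unfolding e d using nz s by (simp add: divide_simps) (simp add: algebra_simps)
  qed
  finally show ?thesis .
qed

lemma prob_space_laplace:
  assumes "0 < s" shows "prob_space (laplace s)"
  using nn_integral_exp_laplace[OF assms, of 0] by (intro prob_spaceI) simp

text \<open>With \<open>r = (l * s)\<^sup>2 \<le> 1 / 4\<close> one has
  \<open>1 / (1 - r) \<le> 1 + 2 * r \<le> exp (2 * r)\<close>.\<close>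

lemma laplace_mgf_le:
  assumes s: "0 < s" and l: "\<bar>l\<bar> * s \<le> 1 / 2"
  shows "(\<integral>\<^sup>+x. ennreal (exp (l * x)) \<partial>laplace s) \<le> ennreal (exp (2 * (l * s)\<^sup>2))"
proof -
  let ?r = "(l * s)\<^sup>2"
  have "?r \<le> (1 / 2)\<^sup>2"
    using l s by (intro power2_le_iff_abs_le[THEN iffD2]) (auto simp: abs_mult)
  then have r: "?r \<le> 1 / 4" by (simp add: power2_eq_square)
  have "0 \<le> ?r * (1 - 2 * ?r)" using r by (intro mult_nonneg_nonneg) auto
  then have "1 \<le> (1 + 2 * ?r) * (1 - ?r)" by (simp add: algebra_simps)
  then have "1 / (1 - ?r) \<le> 1 + 2 * ?r" using r by (simp add: divide_simps)
  also have "\<dots> \<le> exp (2 * ?r)" by (rule exp_ge_add_one_self)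
  finally show ?thesis
    using nn_integral_exp_laplace[OF s, of l] l by (simp add: power_mult_distrib)
qed

text \<open>For negative \<open>x\<close> the bound follows by inverting the quadratic Taylor lower
  bound of \<open>exp (- x)\<close>.\<close>

lemma exp_le_quadratic:
  fixes x :: real
  assumes "x \<le> 1" shows "exp x \<le> 1 + x + x\<^sup>2"
proof (cases "0 \<le> x")
  case True
  then show ?thesis using assms by (intro exp_bound)
next
  case False
  then have "0 < 1 + (- x) + (- x)\<^sup>2 / 2" by (simp add: add_pos_nonneg)
  moreover have "1 + (- x) + (- x)\<^sup>2 / 2 \<le> exp (- x)"
    using False by (intro exp_lower_Taylor_quadratic) auto
  ultimately have "exp x \<le> 1 / (1 + (- x) + (- x)\<^sup>2 / 2)"
    by (simp add: exp_minus field_simps)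
  also have "\<dots> \<le> 1 + x + x\<^sup>2"
  proof -
    have "(1 + x + x\<^sup>2) * (1 + (- x) + (- x)\<^sup>2 / 2) - 1 = x\<^sup>2 / 2 * (1 - x + x\<^sup>2)"
      by (simp add: power2_eq_square algebra_simps field_simps)
    moreover have "0 \<le> x\<^sup>2 / 2 * (1 - x + x\<^sup>2)" using False by (intro mult_nonneg_nonneg) auto
    ultimately show ?thesis
      using \<open>0 < 1 + (- x) + (- x)\<^sup>2 / 2\<close> by (simp add: divide_le_eq)
  qed
  finally show ?thesis .
qed

lemma heavy_tailed_integrable_id:
  assumes "heavy_tailed v u D" "0 \<le> v"
  shows "integrable D (\<lambda>x. x)"
proof -
  interpret real_distribution D using assms by (simp add: heavy_tailed_def)
  have "integrable D (\<lambda>x. 1 + \<bar>x\<bar> powr (1 + v))"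
    using assms by (simp add: heavy_tailed_def)
  moreover have "norm x \<le> norm (1 + \<bar>x\<bar> powr (1 + v))" for x :: real
  proof -
    have "\<bar>x\<bar> \<le> 1 + \<bar>x\<bar> powr (1 + v)"
    proof (cases "\<bar>x\<bar> \<le> 1")
      case False
      then have "\<bar>x\<bar> powr 1 \<le> \<bar>x\<bar> powr (1 + v)" using assms by (intro powr_mono) auto
      then show ?thesis using False by simp
    qed (simp add: add_increasing2)
    then show ?thesis by simp
  qed
  ultimately show ?thesis
    by (intro Bochner_Integration.integrable_bound[where g = "\<lambda>x. x"] AE_I2) auto
qed

text \<open>
  Truncation at \<open>B\<close> biases the mean by at most \<open>u B\<^sup>-\<^sup>v\<close>, and for \<open>\<bar>l\<bar> B \<le> 1\<close> the
  second-order term \<open>l\<^sup>2 u B\<^sup>1\<^sup>-\<^sup>v\<close> of the moment generating function is of the same size as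
  the resulting exponent \<open>\<bar>l\<bar> u B\<^sup>-\<^sup>v\<close>.
\<close>

lemma truncated_mgf_le:
  assumes ht: "heavy_tailed v u D" and v: "0 < v" "v \<le> 1" and B: "0 < B" and l: "\<bar>l\<bar> * B \<le> 1"
  shows "(\<integral>\<^sup>+x. ennreal (exp (l * (if \<bar>x\<bar> \<le> B then x else 0))) \<partial>D)
    \<le> ennreal (exp (l * (\<integral>x. x \<partial>D) + 2 * \<bar>l\<bar> * u * B powr (- v)))"
proof -
  interpret real_distribution D using ht by (simp add: heavy_tailed_def)
  define Y where "Y = (\<lambda>x::real. if \<bar>x\<bar> \<le> B then x else 0)"
  have [measurable]: "Y \<in> borel_measurable borel" unfolding Y_def by measurable
  have Yb: "\<bar>Y x\<bar> \<le> B" for x using B by (simp add: Y_def)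
  have iY: "integrable D Y"
    by (rule integrable_const_bound[where B = B]) (auto simp: Yb)
  have iY2: "integrable D (\<lambda>x. (Y x)\<^sup>2)"
    by (rule integrable_const_bound[where B = "B\<^sup>2"]) (use Yb B in \<open>auto simp: abs_le_square_iff[symmetric] intro: order_trans\<close>)
  have iX: "integrable D (\<lambda>x. x)" using heavy_tailed_integrable_id[OF ht] v by simp
  have iP: "integrable D (\<lambda>x. \<bar>x\<bar> powr (1 + v))" and uP: "(\<integral>x. \<bar>x\<bar> powr (1 + v) \<partial>D) \<le> u"
    using ht by (auto simp: heavy_tailed_def)
  have bias: "\<bar>(\<integral>x. Y x \<partial>D) - (\<integral>x. x \<partial>D)\<bar> \<le> u * B powr (- v)"
  proof -
    have "\<bar>(\<integral>x. Y x \<partial>D) - (\<integral>x. x \<partial>D)\<bar> = \<bar>\<integral>x. Y x - x \<partial>D\<bar>"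
      using iY iX by simp
    also have "\<dots> \<le> (\<integral>x. \<bar>Y x - x\<bar> \<partial>D)" by (rule integral_abs_bound)
    also have "\<dots> \<le> (\<integral>x. \<bar>x\<bar> powr (1 + v) * B powr (- v) \<partial>D)"
    proof (rule integral_mono)
      fix x
      show "\<bar>Y x - x\<bar> \<le> \<bar>x\<bar> powr (1 + v) * B powr (- v)"
      proof (cases "\<bar>x\<bar> \<le> B")
        case False
        \<comment> \<open>Beyond the truncation level this factor is at least 1 and supplies the
          missing power of \<open>\<bar>x\<bar>\<close>.\<close>
        have "1 \<le> (\<bar>x\<bar> / B) powr v" using False B v by (intro ge_one_powr_ge_zero) auto
        also have "\<dots> = \<bar>x\<bar> powr v * B powr (- v)" using B by (simp add: powr_divide powr_minus_divide)
        finally have "\<bar>x\<bar> * 1 \<le> \<bar>x\<bar> * (\<bar>x\<bar> powr v * B powr (- v))" by (intro mult_left_mono) auto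
        then show ?thesis using False B by (simp add: Y_def powr_add mult.assoc)
      qed (simp add: Y_def)
    qed (use iY iX iP in auto)
    also have "\<dots> \<le> u * B powr (- v)" using uP by (simp add: mult_right_mono)
    finally show ?thesis .
  qed
  have second: "(\<integral>x. (Y x)\<^sup>2 \<partial>D) \<le> u * B powr (1 - v)"
  proof -
    have "(\<integral>x. (Y x)\<^sup>2 \<partial>D) \<le> (\<integral>x. \<bar>x\<bar> powr (1 + v) * B powr (1 - v) \<partial>D)"
    proof (rule integral_mono)
      fix x
      show "(Y x)\<^sup>2 \<le> \<bar>x\<bar> powr (1 + v) * B powr (1 - v)"
      proof (cases "\<bar>x\<bar> \<le> B \<and> x \<noteq> 0")
        case True
        then have "x\<^sup>2 = \<bar>x\<bar> powr ((1 + v) + (1 - v))" by (simp add: powr_numeral)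
        also have "\<dots> = \<bar>x\<bar> powr (1 + v) * \<bar>x\<bar> powr (1 - v)" by (rule powr_add)
        also have "\<dots> \<le> \<bar>x\<bar> powr (1 + v) * B powr (1 - v)"
          using True v by (intro mult_left_mono powr_mono2) auto
        finally show ?thesis using True by (simp add: Y_def)
      qed (auto simp: Y_def)
    qed (use iY2 iP in auto)
    also have "\<dots> \<le> u * B powr (1 - v)" using uP by (simp add: mult_right_mono)
    finally show ?thesis .
  qed
  have u0: "0 \<le> u" using uP by (rule order_trans[rotated]) (simp add: integral_nonneg_AE)
  have "(\<integral>\<^sup>+x. ennreal (exp (l * Y x)) \<partial>D) \<le> (\<integral>\<^sup>+x. ennreal (1 + l * Y x + l\<^sup>2 * (Y x)\<^sup>2) \<partial>D)"
  proof (intro nn_integral_mono ennreal_leI)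
    fix x
    have "\<bar>l * Y x\<bar> \<le> \<bar>l\<bar> * B" unfolding abs_mult using Yb by (intro mult_left_mono) auto
    then have "l * Y x \<le> 1" using l by linarith
    from exp_le_quadratic[OF this] show "exp (l * Y x) \<le> 1 + l * Y x + l\<^sup>2 * (Y x)\<^sup>2"
      by (simp add: power_mult_distrib)
  qed
  also have "\<dots> = ennreal (\<integral>x. 1 + l * Y x + l\<^sup>2 * (Y x)\<^sup>2 \<partial>D)"
  proof (rule nn_integral_eq_integral)
    show "AE x in D. 0 \<le> 1 + l * Y x + l\<^sup>2 * (Y x)\<^sup>2"
    proof (rule AE_I2)
      fix x
      \<comment> \<open>Completing the square shows that the quadratic is nonnegative, so its
        Lebesgue integral is the usual one.\<close>
      have "0 \<le> (1 / 2 + l * Y x)\<^sup>2 + 3 / 4" by simp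
      also have "\<dots> = 1 + l * Y x + l\<^sup>2 * (Y x)\<^sup>2" by (simp add: power2_eq_square algebra_simps)
      finally show "0 \<le> 1 + l * Y x + l\<^sup>2 * (Y x)\<^sup>2" .
    qed
  qed (use iY iY2 in auto)
  also have "(\<integral>x. 1 + l * Y x + l\<^sup>2 * (Y x)\<^sup>2 \<partial>D) = 1 + l * (\<integral>x. Y x \<partial>D) + l\<^sup>2 * (\<integral>x. (Y x)\<^sup>2 \<partial>D)"
    using iY iY2 prob_space by simp
  also have "ennreal \<dots> \<le> ennreal (exp (l * (\<integral>x. x \<partial>D) + 2 * \<bar>l\<bar> * u * B powr (- v)))"
  proof (rule ennreal_leI)
    have "l * ((\<integral>x. Y x \<partial>D) - (\<integral>x. x \<partial>D)) \<le> \<bar>l\<bar> * (u * B powr (- v))"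
      by (rule order_trans[OF abs_ge_self]) (simp add: abs_mult mult_left_mono bias)
    moreover have "l\<^sup>2 * (\<integral>x. (Y x)\<^sup>2 \<partial>D) \<le> \<bar>l\<bar> * (u * B powr (- v))"
    proof -
      have "l\<^sup>2 * (\<integral>x. (Y x)\<^sup>2 \<partial>D) \<le> l\<^sup>2 * (u * B powr (1 - v))"
        using second by (intro mult_left_mono) auto
      also have "\<dots> = (\<bar>l\<bar> * B) * (\<bar>l\<bar> * (u * B powr (- v)))"
        using B by (simp add: powr_diff powr_minus power2_eq_square field_simps)
      also have "\<dots> \<le> 1 * (\<bar>l\<bar> * (u * B powr (- v)))"
        using l u0 by (intro mult_right_mono) auto
      finally show ?thesis by simp
    qed
    ultimately have "1 + l * (\<integral>x. Y x \<partial>D) + l\<^sup>2 * (\<integral>x. (Y x)\<^sup>2 \<partial>D)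
        \<le> 1 + (l * (\<integral>x. x \<partial>D) + 2 * \<bar>l\<bar> * u * B powr (- v))"
      by (simp add: algebra_simps)
    also have "\<dots> \<le> exp (l * (\<integral>x. x \<partial>D) + 2 * \<bar>l\<bar> * u * B powr (- v))"
      by (rule exp_ge_add_one_self)
    finally show "1 + l * (\<integral>x. Y x \<partial>D) + l\<^sup>2 * (\<integral>x. (Y x)\<^sup>2 \<partial>D)
        \<le> exp (l * (\<integral>x. x \<partial>D) + 2 * \<bar>l\<bar> * u * B powr (- v))" .
  qed
  finally show ?thesis by (simp add: Y_def)
qed

section \<open>Integrals over product measures\<close>

lemma nn_integral_pair_mult:
  assumes "prob_space M" "prob_space N"
    and [measurable]: "f \<in> borel_measurable M" "g \<in> borel_measurable N"
  shows "(\<integral>\<^sup>+p. f (fst p) * g (snd p) \<partial>(M \<Otimes>\<^sub>M N)) = (\<integral>\<^sup>+x. f x \<partial>M) * (\<integral>\<^sup>+y. g y \<partial>N)"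
proof -
  interpret N: prob_space N by fact
  have "(\<integral>\<^sup>+p. f (fst p) * g (snd p) \<partial>(M \<Otimes>\<^sub>M N)) = (\<integral>\<^sup>+x. (\<integral>\<^sup>+y. f x * g y \<partial>N) \<partial>M)"
    using N.nn_integral_fst[of "\<lambda>p. f (fst p) * g (snd p)" M] by simp
  also have "\<dots> = (\<integral>\<^sup>+x. f x * (\<integral>\<^sup>+y. g y \<partial>N) \<partial>M)"
    by (intro nn_integral_cong nn_integral_cmult) auto
  also have "\<dots> = (\<integral>\<^sup>+x. f x \<partial>M) * (\<integral>\<^sup>+y. g y \<partial>N)" by (rule nn_integral_multc) auto
  finally show ?thesis .
qed

lemma nn_integral_PiM_prod:
  assumes "finite I" "\<And>i. i \<in> I \<Longrightarrow> prob_space (M i)"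
    and "\<And>i. i \<in> I \<Longrightarrow> f i \<in> borel_measurable (M i)"
  shows "(\<integral>\<^sup>+x. (\<Prod>i\<in>I. f i (x i)) \<partial>Pi\<^sub>M I M) = (\<Prod>i\<in>I. \<integral>\<^sup>+x. f i x \<partial>M i)"
proof -
  \<comment> \<open>\<open>product_sigma_finite\<close> asks for sigma-finite measures at every
    index, while \<open>M\<close> is controlled on \<open>I\<close> only; a one-point counting
    measure fills the rest.\<close>
  define N where "N i = (if i \<in> I then M i else count_space {undefined})" for i
  interpret product_sigma_finite N
    by (rule product_sigma_finite.intro)
      (auto simp: N_def assms(2) prob_space_imp_sigma_finite intro!: sigma_finite_measure_count_space_finite)
  have "Pi\<^sub>M I M = Pi\<^sub>M I N" by (rule PiM_cong) (auto simp: N_def)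
  then have "(\<integral>\<^sup>+x. (\<Prod>i\<in>I. f i (x i)) \<partial>Pi\<^sub>M I M) = (\<integral>\<^sup>+x. (\<Prod>i\<in>I. f i (x i)) \<partial>Pi\<^sub>M I N)" by simp
  also have "\<dots> = (\<Prod>i\<in>I. \<integral>\<^sup>+x. f i x \<partial>N i)"
    by (rule product_nn_integral_prod) (simp_all add: N_def assms)
  also have "\<dots> = (\<Prod>i\<in>I. \<integral>\<^sup>+x. f i x \<partial>M i)" by (rule prod.cong) (auto simp: N_def)
  finally show ?thesis .
qed

text \<open>\<open>inv\<close> says that \<open>h\<close> ignores coordinate \<open>i\<close>, so
  Fubini with this coordinate integrated innermost pulls \<open>h\<close> out. It serves to separate
  a reward from the event that it is collected.\<close>

lemma integral_PiM_mult_indep: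
  fixes f :: "'a \<Rightarrow> real" and h :: "('i \<Rightarrow> 'a) \<Rightarrow> real"
  assumes I: "finite I" "i \<in> I" and M: "\<And>j. j \<in> I \<Longrightarrow> prob_space (M j)"
    and f: "integrable (M i) f"
    and h: "h \<in> borel_measurable (Pi\<^sub>M I M)" "\<And>\<omega>. \<bar>h \<omega>\<bar> \<le> c"
    and inv: "\<And>w x. h (w(i := x)) = h w"
  shows "integrable (Pi\<^sub>M I M) (\<lambda>\<omega>. f (\<omega> i) * h \<omega>)"
    and "(\<integral>\<omega>. f (\<omega> i) * h \<omega> \<partial>Pi\<^sub>M I M) = (\<integral>x. f x \<partial>M i) * (\<integral>\<omega>. h \<omega> \<partial>Pi\<^sub>M I M)"
proof -
  define N where "N j = (if j \<in> I then M j else count_space {undefined})" for j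
  interpret product_sigma_finite N
    by (rule product_sigma_finite.intro)
      (auto simp: N_def M prob_space_imp_sigma_finite intro!: sigma_finite_measure_count_space_finite)
  have NM: "Pi\<^sub>M I N = Pi\<^sub>M I M" by (rule PiM_cong) (auto simp: N_def)
  interpret P: prob_space "Pi\<^sub>M I M" by (rule prob_space_PiM) fact
  interpret Mi: prob_space "M i" using M I by simp
  have "integrable (distr (Pi\<^sub>M I M) (M i) (\<lambda>\<omega>. \<omega> i)) f"
    using f by (subst distr_PiM_component[OF M I(2)]) simp
  then have fi: "integrable (Pi\<^sub>M I M) (\<lambda>\<omega>. f (\<omega> i))"
    by (rule integrable_distr[OF measurable_component_singleton[OF I(2)]])
  have "integrable (Pi\<^sub>M I M) (\<lambda>\<omega>. c * f (\<omega> i))" using fi by simp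
  then show int: "integrable (Pi\<^sub>M I M) (\<lambda>\<omega>. f (\<omega> i) * h \<omega>)"
  proof (rule Bochner_Integration.integrable_bound)
    show "(\<lambda>\<omega>. f (\<omega> i) * h \<omega>) \<in> borel_measurable (Pi\<^sub>M I M)"
      by (intro borel_measurable_times borel_measurable_integrable fi h(1))
    have "\<bar>f (\<omega> i)\<bar> * \<bar>h \<omega>\<bar> \<le> \<bar>f (\<omega> i)\<bar> * \<bar>c\<bar>" for \<omega>
      using h(2)[of \<omega>] by (intro mult_left_mono) auto
    then show "AE \<omega> in Pi\<^sub>M I M. norm (f (\<omega> i) * h \<omega>) \<le> norm (c * f (\<omega> i))"
      by (intro AE_I2) (simp add: abs_mult mult.commute)
  qed
  have ih: "integrable (Pi\<^sub>M I M) h"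
    by (rule P.integrable_const_bound[where B = c]) (use h in auto)
  define J where "J = I - {i}"
  have J: "insert i J = I" "finite J" "i \<notin> J" using I by (auto simp: J_def)
  have Ni: "N i = M i" using I by (simp add: N_def)
  have "(\<integral>\<omega>. f (\<omega> i) * h \<omega> \<partial>Pi\<^sub>M I M)
      = (\<integral>\<omega>. (\<integral>y. f y * h \<omega> \<partial>M i) \<partial>Pi\<^sub>M J N)"
    using product_integral_insert[of J i "\<lambda>\<omega>. f (\<omega> i) * h \<omega>"] J int by (simp add: NM Ni inv)
  also have "\<dots> = (\<integral>x. f x \<partial>M i) * (\<integral>\<omega>. h \<omega> \<partial>Pi\<^sub>M J N)" by simp
  also have "(\<integral>\<omega>. h \<omega> \<partial>Pi\<^sub>M J N) = (\<integral>\<omega>. h \<omega> \<partial>Pi\<^sub>M I M)"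
    \<comment> \<open>Fubini for \<open>h\<close> alone puts coordinate \<open>i\<close> back,
      because \<open>M i\<close> has mass 1.\<close>
    using product_integral_insert[of J i h] J ih by (simp add: NM Ni inv Mi.prob_space)
  finally show "(\<integral>\<omega>. f (\<omega> i) * h \<omega> \<partial>Pi\<^sub>M I M)
      = (\<integral>x. f x \<partial>M i) * (\<integral>\<omega>. h \<omega> \<partial>Pi\<^sub>M I M)" .
qed

text \<open>Only the first \<open>n\<close> entries of row \<open>a\<close> contribute to the moment
  generating function of a private sum. The lemma is applied twice: to the integrand and to the
  product of the integrals.\<close>

lemma prod_row:
  fixes F :: "nat \<times> nat \<Rightarrow> 'b :: comm_monoid_mult"
  assumes "a \<in> {1..K}" "n \<le> T" "\<And>p. p \<in> {1..K} \<times> {1..T} - Pair a ` {1..n} \<Longrightarrow> F p = 1"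
  shows "prod F ({1..K} \<times> {1..T}) = (\<Prod>i = 1..n. F (a, i))"
proof -
  have "prod F ({1..K} \<times> {1..T}) = prod F (Pair a ` {1..n})"
    by (rule prod.mono_neutral_right) (use assms in auto)
  also have "\<dots> = (\<Prod>i = 1..n. F (a, i))"
    by (subst prod.reindex) (auto simp: inj_on_def)
  finally show ?thesis .
qed

section \<open>Elementary sums, maximizers and counters\<close>

text \<open>Each summand is at most \<open>2 * (sqrt i - sqrt (i - 1))\<close>, and these
  differences telescope.\<close>

lemma sum_inverse_sqrt_le: "(\<Sum>i = 1..n. 1 / sqrt (real i)) \<le> 2 * sqrt (real n)"
proof (induction n)
  case (Suc n)
  have "1 / sqrt (real (Suc n)) \<le> 2 * (sqrt (real (Suc n)) - sqrt (real n))"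
  proof -
    let ?s = "sqrt (real (Suc n))" and ?r = "sqrt (real n)"
    have s: "0 < ?s" by simp
    have "1 = (?s - ?r) * (?s + ?r)" by (simp add: algebra_simps flip: power2_eq_square)
    also have "\<dots> \<le> (?s - ?r) * (2 * ?s)" by (intro mult_left_mono) auto
    finally have "1 \<le> (2 * (?s - ?r)) * ?s" by (simp only: mult_ac)
    then show ?thesis using s by (simp add: divide_le_eq)
  qed
  then show ?case using Suc by simp
qed simp

lemma is_arg_max_set_nonempty:
  fixes f :: "nat \<Rightarrow> real"
  assumes "finite A" "A \<noteq> {}"
  shows "{a. is_arg_max f (\<lambda>a. a \<in> A) a} \<noteq> {}"
proof -
  have "Max (f ` A) \<in> f ` A" using assms by (intro Max_in) auto
  then obtain x where x: "x \<in> A" "f x = Max (f ` A)" by auto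
  have "is_arg_max f (\<lambda>a. a \<in> A) x"
    unfolding is_arg_max_def using x assms by (auto simp: not_less)
  then show ?thesis by auto
qed

lemma is_arg_max_set_eq:
  fixes f :: "nat \<Rightarrow> real"
  shows "{a. is_arg_max f (\<lambda>a. a \<in> A) a} = {a \<in> A. \<forall>c\<in>A. f c \<le> f a}"
  by (auto simp: is_arg_max_def not_less)

text \<open>Pull counters are the counts of a finite list of pulled arms. This places them in the
  countable set \<open>range count_list\<close>, which is closed under incrementing one
  counter.\<close>

lemma count_list_Cons: "count_list (a # xs) = (count_list xs)(a := count_list xs a + 1)"
  by auto

text \<open>The sharper bound \<open>2 - 1 / n\<close> is inductive, by comparison with the
  telescoping sum of \<open>1 / (n * (n + 1))\<close>.\<close>

lemma sum_inverse_square_le: "(\<Sum>t = 1..n. 1 / (real t)\<^sup>2) \<le> 2"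
proof -
  have "(\<Sum>t = 1..Suc m. 1 / (real t)\<^sup>2) \<le> 2 - 1 / real (Suc m)" for m
  proof (induction m)
    case (Suc m)
    have "1 / (real (Suc (Suc m)))\<^sup>2 \<le> 1 / (real (Suc m) * real (Suc (Suc m)))"
      by (intro divide_left_mono) (auto simp: power2_eq_square)
    also have "\<dots> = 1 / real (Suc m) - 1 / real (Suc (Suc m))" by (simp add: field_simps)
    finally show ?case using Suc by simp
  qed simp
  from this[of "n - 1"] show ?thesis
    by (cases n) (auto intro: order_trans)
qed

section \<open>Comparison of the exponents of the logarithm\<close>

text \<open>
  \<open>l\<close> stands for \<open>log b (2 t\<^sup>4)\<close> and \<open>k\<close> for the number of noise terms. The three summands on
  the left are the truncation bias, the variance and the deviation term of the Chernoff bound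
  with parameter \<open>1 / (s w)\<close>; each is smaller than the confidence width by a factor of order \<open>w\<close>.
\<close>

lemma width_dominates:
  fixes L l k w v c \<beta> :: real
  assumes v: "0 < v" "v \<le> 1" and w: "w = L powr (1 / 4)" and L: "1 \<le> L"
    and c: "0 < c" "c \<le> 1" "c \<le> l" and l: "l \<le> 5 * L" and k: "k \<le> 2 * L / c"
    and \<beta>: "0 \<le> \<beta>" and big: "2 / c\<^sup>2 \<le> w" "2 * \<beta> \<le> w"
  shows "4 * L powr (1.5 * (v / (1 + v))) + (2 * k / w + \<beta> * l * w) * (2 * L powr (1 - 1.5 / (1 + v)))
    \<le> 18 * l powr (v / (1 + v)) * L powr ((1.5 + 1 / v) * (v / (1 + v)))"
proof -
  \<comment> \<open>All exponents are expressed through \<open>y\<close>, which lies in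
    \<open>[1/2, 1]\<close>: \<open>p = 1 - y\<close> and \<open>q = 1.5 - y / 2\<close>, the latter
    being the exponent of \<open>L\<close> in the width.\<close>
  define y where "y = 1 / (1 + v)"
  define p where "p = v / (1 + v)"
  define q where "q = (1.5 + 1 / v) * p"
  have y: "1 / 2 \<le> y" "y \<le> 1" using v by (auto simp: y_def field_simps)
  have py: "p = 1 - y" using v by (simp add: p_def y_def field_simps)
  have y15: "1.5 / (1 + v) = 1.5 * y" by (simp add: y_def)
  have "1 / v * p = y" using v by (simp add: p_def y_def)
  then have qp: "q = 1.5 * p + y" unfolding q_def distrib_right by simp
  then have q: "q = 1.5 - y / 2" by (simp add: py field_simps)
  have p: "0 < p" "p \<le> 1" using v by (auto simp: p_def)
  have l0: "0 < l" using c by simp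
  have w1: "1 \<le> w" unfolding w using L by (intro ge_one_powr_ge_zero) auto
  \<comment> \<open>For a large base \<open>l\<close> may be below 1, so \<open>c\<close> takes the
    place of 1 as a lower bound.\<close>
  have lp: "c \<le> l powr p"
  proof -
    have "c = c powr 1" using c by simp
    also have "\<dots> \<le> c powr p" using c p by (intro powr_mono') auto
    also have "\<dots> \<le> l powr p" using c p by (intro powr_mono2) auto
    finally show ?thesis .
  qed
  have c2w: "2 \<le> c\<^sup>2 * w" using big(1) c by (simp add: divide_le_eq mult.commute)
  have cw: "1 \<le> c * w"
  proof -
    have "c\<^sup>2 * w \<le> c * w" using c w1 by (intro mult_right_mono) (auto simp: power2_eq_square mult_le_one)
    then show ?thesis using c2w by simp
  qed
  \<comment> \<open>The constant 18 is shared out equally: each of the three terms is allowed 6. For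
    the bias, \<open>L powr y \<ge> w\<close> outweighs \<open>1 / c\<close>.\<close>
  have A: "4 * L powr (1.5 * p) \<le> 6 * l powr p * L powr q"
  proof -
    have "1 \<le> c * w" by (rule cw)
    also have "\<dots> \<le> l powr p * L powr y"
      unfolding w using lp c L y by (intro mult_mono powr_mono) auto
    finally have "L powr (1.5 * p) * 1 \<le> L powr (1.5 * p) * (l powr p * L powr y)"
      by (intro mult_left_mono) auto
    also have "\<dots> = l powr p * L powr (1.5 * p + y)" by (simp add: powr_add)
    also have "1.5 * p + y = q" by (rule qp[symmetric])
    finally have "L powr (1.5 * p) \<le> l powr p * L powr q" by simp
    moreover have "0 \<le> l powr p * L powr q" by simp
    ultimately show ?thesis unfolding mult.assoc by linarith
  qed
  \<comment> \<open>The exponent \<open>2 - 1.5 * y\<close> is at most \<open>q\<close> exactly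
    because \<open>y \<ge> 1 / 2\<close>; the growth of \<open>w\<close> takes care of the
    constants.\<close>
  have Bd: "2 * k / w * (2 * L powr (1 - 1.5 * y)) \<le> 6 * l powr p * L powr q"
  proof -
    have "2 * k / w * (2 * L powr (1 - 1.5 * y)) \<le> 2 * (2 * L / c) / w * (2 * L powr (1 - 1.5 * y))"
      using k w1 by (intro mult_right_mono divide_right_mono mult_left_mono) auto
    also have "\<dots> = 8 / (c * w) * (L powr 1 * L powr (1 - 1.5 * y))" using L by simp
    also have "L powr 1 * L powr (1 - 1.5 * y) = L powr (1 + (1 - 1.5 * y))"
      by (rule powr_add[symmetric])
    also have "8 / (c * w) * \<dots> \<le> 8 / (c * w) * L powr q"
      using L y c w1 by (intro mult_left_mono powr_mono) (auto simp: q)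
    also have "8 / (c * w) \<le> 4 * c"
      using c2w c w1 by (simp add: divide_le_eq power2_eq_square mult_ac)
    also have "4 * c * L powr q \<le> 6 * l powr p * L powr q" using lp c by (intro mult_right_mono) auto
    finally show ?thesis by (simp add: mult_right_mono)
  qed
  \<comment> \<open>Besides \<open>w\<close> itself, the bound \<open>2 * \<beta> \<le> w\<close>
    gives another \<open>L powr (1 / 4)\<close>. Together they raise the exponent of
    \<open>L\<close> to exactly \<open>q\<close>.\<close>
  have Cd: "\<beta> * l * w * (2 * L powr (1 - 1.5 * y)) \<le> 6 * l powr p * L powr q"
  proof -
    have "l = l powr p * l powr y"
      using l0 by (simp add: py flip: powr_add)
    also have "\<dots> \<le> l powr p * (5 * L) powr y"
      using l l0 y by (intro mult_left_mono powr_mono2) auto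
    also have "(5 * L) powr y = 5 powr y * L powr y"
      using L by (simp add: powr_mult)
    also have "5 powr y \<le> 5 powr (1 :: real)" using y by (intro powr_mono) auto
    finally have l5: "l \<le> l powr p * (5 * L powr y)"
      by (simp add: mult_left_mono mult_right_mono)
    have "\<beta> * l * w * (2 * L powr (1 - 1.5 * y))
        \<le> \<beta> * (l powr p * (5 * L powr y)) * w * (2 * L powr (1 - 1.5 * y))"
      using l5 \<beta> w1 by (intro mult_right_mono mult_left_mono) auto
    also have "\<dots> = 5 * (2 * \<beta>) * l powr p * (L powr y * L powr (1 / 4) * L powr (1 - 1.5 * y))"
      unfolding w by simp
    also have "\<dots> \<le> 5 * w * l powr p * (L powr y * L powr (1 / 4) * L powr (1 - 1.5 * y))"
      using big(2) by (intro mult_right_mono) auto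
    also have "\<dots> = 5 * l powr p * L powr (y + 1 / 4 + (1 - 1.5 * y) + 1 / 4)"
      unfolding w by (simp only: powr_add mult_ac)
    also have "y + 1 / 4 + (1 - 1.5 * y) + 1 / 4 = q"
      by (simp add: q)
    also have "5 * l powr p * L powr q \<le> 6 * l powr p * L powr q" by (intro mult_right_mono) auto
    finally show ?thesis .
  qed
  show ?thesis
    using A Bd Cd unfolding y15 p_def[symmetric] q_def[symmetric] by (simp add: algebra_simps)
qed

section \<open>Concentration of the private sums\<close>

locale dp_bandit =
  fixes b \<epsilon> v u :: real and K T :: nat and tie :: "nat \<Rightarrow> nat set \<Rightarrow> nat"
    and D :: "nat \<Rightarrow> real measure"
  assumes b: "1 < b" and v: "0 < v" "v \<le> 1" and u: "0 < u" and eps: "0 < \<epsilon>" "\<epsilon> \<le> 1"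
    and K: "1 \<le> K" and T: "2 \<le> T" and tie: "tie_rule K tie"
    and ht: "\<And>a. a \<in> {1..K} \<Longrightarrow> heavy_tailed v u (D a)"
begin

abbreviation "L \<equiv> log b (real T)"
abbreviation "B \<equiv> trunc_level b \<epsilon> v u T"
abbreviation "s \<equiv> noise_scale b \<epsilon> v u T"
abbreviation "\<mu> a \<equiv> \<integral>x. x \<partial>D a"
abbreviation "M \<equiv> table_measure b \<epsilon> v u K T D"
abbreviation "S \<equiv> private_sum b \<epsilon> v u T"
abbreviation "entries \<equiv> {1..K} \<times> {1..T}"
abbreviation "entry \<equiv> (\<lambda>(a, n). D a \<Otimes>\<^sub>M laplace (s n))"

lemma L_pos: "0 < L" using b T by simp

lemma B_pos: "1 \<le> n \<Longrightarrow> 0 < B n"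
  using eps u L_pos by (simp add: trunc_level_def)

lemma s_pos: "1 \<le> n \<Longrightarrow> 0 < s n"
  using eps L_pos B_pos by (simp add: noise_scale_def)

lemma B_mono: "m \<le> n \<Longrightarrow> B m \<le> B n"
  unfolding trunc_level_def using eps u v L_pos
  by (intro powr_mono2 divide_right_mono mult_left_mono) auto

lemma s_mono: "m \<le> n \<Longrightarrow> s m \<le> s n"
  unfolding noise_scale_def using eps L_pos B_mono
  by (intro divide_right_mono mult_left_mono) auto

lemma prob_D: "a \<in> {1..K} \<Longrightarrow> prob_space (D a)"
  and sets_D: "a \<in> {1..K} \<Longrightarrow> sets (D a) = sets borel"
  using ht[of a] unfolding heavy_tailed_def real_distribution_def real_distribution_axioms_def by auto

lemma prob_entry: "p \<in> entries \<Longrightarrow> prob_space (entry p)"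
  by (auto intro!: prob_space_pair prob_D prob_space_laplace s_pos)

lemma sets_entry: "p \<in> entries \<Longrightarrow> sets (entry p) = sets (borel \<Otimes>\<^sub>M borel)"
  by (auto intro!: sets_pair_measure_cong sets_D)

lemma M_eq: "M = Pi\<^sub>M entries entry"
  unfolding table_measure_def by (rule PiM_cong) auto

sublocale M: prob_space M
  unfolding M_eq by (rule prob_space_PiM) (rule prob_entry)

text \<open>Outside the index set a coordinate is constantly \<open>undefined\<close>. Stating the
  fact for every \<open>p\<close> spares side conditions in later measurability proofs.\<close>

lemma measurable_entry [measurable]: "(\<lambda>\<omega>. \<omega> p) \<in> measurable M (borel \<Otimes>\<^sub>M borel)"
proof (cases "p \<in> entries")
  case True
  then have "(\<lambda>\<omega>. \<omega> p) \<in> measurable M (entry p)"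
    unfolding M_eq by (rule measurable_component_singleton)
  then show ?thesis using measurable_cong_sets[OF refl sets_entry[OF True]] by blast
next
  case False
  have "\<omega> p = undefined" if "\<omega> \<in> space M" for \<omega>
    using that False unfolding M_eq space_PiM by (rule PiE_arb)
  then have "(\<lambda>\<omega>. \<omega> p) \<in> measurable M (borel \<Otimes>\<^sub>M borel)
    \<longleftrightarrow> (\<lambda>\<omega>. undefined) \<in> measurable M (borel \<Otimes>\<^sub>M (borel :: real measure) :: (real \<times> real) measure)"
    by (rule measurable_cong)
  then show ?thesis by (simp add: space_pair_measure)
qed

lemma private_sum_eq:
  "S \<omega> a n = (\<Sum>i = 1..n. arm_stream b \<epsilon> v u T \<omega> a i) + (\<Sum>m\<in>noise_items n. snd (\<omega> (a, m)))"
  by (simp add: private_sum_def tree_output_eq)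

lemma measurable_private_sum [measurable]: "(\<lambda>\<omega>. S \<omega> a n) \<in> borel_measurable M"
  unfolding private_sum_eq arm_stream_def Let_def by measurable

text \<open>The exponential of the centred sum is a product over the independent entries of row
  \<open>a\<close>. An entry contributes its truncated reward and, if its index lies in
  \<open>noise_items n\<close>, its Laplace noise, whose scale is at most \<open>s n\<close> by
  monotonicity.\<close>

lemma private_sum_mgf:
  assumes a: "a \<in> {1..K}" and n: "1 \<le> n" "n \<le> T"
    and l: "\<bar>l\<bar> * s n \<le> 1 / 2" "\<bar>l\<bar> * B n \<le> 1"
  shows "(\<integral>\<^sup>+\<omega>. ennreal (exp (l * (S \<omega> a n - n * \<mu> a))) \<partial>M)
    \<le> ennreal (exp (2 * \<bar>l\<bar> * u * (\<Sum>i = 1..n. B i powr (- v)) + 2 * real (card (noise_items n)) * (l * s n)\<^sup>2))"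
proof -
  let ?A = "noise_items n"
  note A = noise_items_subset[of n]
  have finA: "finite ?A" by (rule finite_subset[OF A]) simp
  define f where "f i x = exp (l * ((if \<bar>x\<bar> \<le> B i then x else 0) - \<mu> a))" for i x
  define g where "g i z = (if i \<in> ?A then exp (l * z) else 1)" for i and z :: real
  \<comment> \<open>The value 1 outside the first \<open>n\<close> entries of the row lets the
    product range over the whole table.\<close>
  define F where "F p x = (if p \<in> Pair a ` {1..n} then ennreal (f (snd p) (fst x)) * ennreal (g (snd p) (snd x)) else 1)"
    for p :: "nat \<times> nat" and x :: "real \<times> real"
  have [measurable]: "f i \<in> borel_measurable borel" "g i \<in> borel_measurable borel" for i
    unfolding f_def g_def by measurable
  have g0: "0 \<le> g i z" for i z by (simp add: g_def)
  have f0: "0 \<le> f i z" for i z by (simp add: f_def)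
  have split: "ennreal (exp (l * (S \<omega> a n - n * \<mu> a))) = (\<Prod>p\<in>entries. F p (\<omega> p))" for \<omega>
  proof -
    have "l * (S \<omega> a n - n * \<mu> a) = (\<Sum>i = 1..n. l * ((if \<bar>fst (\<omega> (a, i))\<bar> \<le> B i then fst (\<omega> (a, i)) else 0) - \<mu> a))
        + (\<Sum>i\<in>?A. l * snd (\<omega> (a, i)))"
      by (simp add: private_sum_eq arm_stream_def Let_def sum_subtractf flip: sum_distrib_left) (simp add: algebra_simps)
    then have "exp (l * (S \<omega> a n - n * \<mu> a)) = (\<Prod>i = 1..n. f i (fst (\<omega> (a, i)))) * (\<Prod>i\<in>?A. exp (l * snd (\<omega> (a, i))))"
      using finA by (simp add: exp_add exp_sum f_def)
    also have "(\<Prod>i\<in>?A. exp (l * snd (\<omega> (a, i)))) = (\<Prod>i = 1..n. g i (snd (\<omega> (a, i))))"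
      using A by (simp add: g_def prod.inter_restrict[symmetric] Int_absorb1)
    finally have "exp (l * (S \<omega> a n - n * \<mu> a)) = (\<Prod>i = 1..n. f i (fst (\<omega> (a, i))) * g i (snd (\<omega> (a, i))))"
      by (simp add: prod.distrib)
    then have "ennreal (exp (l * (S \<omega> a n - n * \<mu> a)))
        = (\<Prod>i = 1..n. ennreal (f i (fst (\<omega> (a, i)))) * ennreal (g i (snd (\<omega> (a, i)))))"
      using f0 g0 by (simp add: prod_ennreal flip: ennreal_mult)
    also have "\<dots> = (\<Prod>i = 1..n. F (a, i) (\<omega> (a, i)))" by (rule prod.cong) (auto simp: F_def)
    also have "\<dots> = (\<Prod>p\<in>entries. F p (\<omega> p))"
      using a n(2) by (rule prod_row[symmetric]) (simp add: F_def)
    finally show ?thesis .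
  qed
  have Fm: "F p \<in> borel_measurable (entry p)" if "p \<in> entries" for p
  proof -
    have "F p \<in> borel_measurable (borel \<Otimes>\<^sub>M borel)" unfolding F_def by measurable
    then show ?thesis using measurable_cong_sets[OF sets_entry[OF that] refl] by blast
  qed
  have "(\<integral>\<^sup>+\<omega>. ennreal (exp (l * (S \<omega> a n - n * \<mu> a))) \<partial>M) = (\<Prod>p\<in>entries. \<integral>\<^sup>+x. F p x \<partial>entry p)"
    unfolding split M_eq by (rule nn_integral_PiM_prod[OF _ prob_entry Fm]) simp_all
  also have "\<dots> = (\<Prod>i = 1..n. \<integral>\<^sup>+x. F (a, i) x \<partial>entry (a, i))"
    using a n(2)
  proof (rule prod_row)
    fix p assume p: "p \<in> entries - Pair a ` {1..n}"
    interpret prob_space "entry p" using p by (intro prob_entry) simp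
    have "F p = (\<lambda>_. 1)" using p by (auto simp: F_def)
    then show "(\<integral>\<^sup>+x. F p x \<partial>entry p) = 1" by (simp add: emeasure_space_1)
  qed
  also have "\<dots> = (\<Prod>i = 1..n. (\<integral>\<^sup>+x. f i x \<partial>D a) * (\<integral>\<^sup>+z. g i z \<partial>laplace (s i)))"
  proof (rule prod.cong)
    fix i assume i: "i \<in> {1..n}"
    have [measurable_cong]: "sets (D a) = sets borel" using a by (rule sets_D)
    show "(\<integral>\<^sup>+x. F (a, i) x \<partial>entry (a, i)) = (\<integral>\<^sup>+x. f i x \<partial>D a) * (\<integral>\<^sup>+z. g i z \<partial>laplace (s i))"
      using i nn_integral_pair_mult[OF prob_D[OF a] prob_space_laplace[OF s_pos], of i "\<lambda>x. ennreal (f i x)" "\<lambda>z. ennreal (g i z)"]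
      by (simp add: F_def)
  qed simp
  also have "\<dots> \<le> (\<Prod>i = 1..n. ennreal (exp (2 * \<bar>l\<bar> * u * B i powr (- v))) * ennreal (exp (if i \<in> ?A then 2 * (l * s n)\<^sup>2 else 0)))"
  proof (rule prod_mono_ennreal, rule mult_mono)
    fix i assume i: "i \<in> {1..n}"
    have "\<bar>l\<bar> * B i \<le> \<bar>l\<bar> * B n" using i by (intro mult_left_mono B_mono) auto
    then have lB: "\<bar>l\<bar> * B i \<le> 1" using l by simp
    have ls: "\<bar>l\<bar> * s i \<le> \<bar>l\<bar> * s n" using i by (intro mult_left_mono s_mono) auto
    have [measurable_cong]: "sets (D a) = sets borel" using a by (rule sets_D)
    have "(\<integral>\<^sup>+x. f i x \<partial>D a) = (\<integral>\<^sup>+x. ennreal (exp (- l * \<mu> a)) * ennreal (exp (l * (if \<bar>x\<bar> \<le> B i then x else 0))) \<partial>D a)"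
      by (intro nn_integral_cong) (simp add: f_def flip: ennreal_mult exp_add, simp add: algebra_simps)
    also have "\<dots> = ennreal (exp (- l * \<mu> a)) * (\<integral>\<^sup>+x. ennreal (exp (l * (if \<bar>x\<bar> \<le> B i then x else 0))) \<partial>D a)"
      by (rule nn_integral_cmult) measurable
    also have "\<dots> \<le> ennreal (exp (- l * \<mu> a)) * ennreal (exp (l * \<mu> a + 2 * \<bar>l\<bar> * u * B i powr (- v)))"
      using truncated_mgf_le[OF ht[OF a] v B_pos lB] i by (intro mult_left_mono) auto
    also have "\<dots> = ennreal (exp (2 * \<bar>l\<bar> * u * B i powr (- v)))"
      by (simp flip: ennreal_mult exp_add)
    finally show "(\<integral>\<^sup>+x. f i x \<partial>D a) \<le> ennreal (exp (2 * \<bar>l\<bar> * u * B i powr (- v)))" .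
    show "(\<integral>\<^sup>+z. g i z \<partial>laplace (s i)) \<le> ennreal (exp (if i \<in> ?A then 2 * (l * s n)\<^sup>2 else 0))"
    proof (cases "i \<in> ?A")
      case True
      have "(\<integral>\<^sup>+z. ennreal (exp (l * z)) \<partial>laplace (s i)) \<le> ennreal (exp (2 * (l * s i)\<^sup>2))"
        using i ls l by (intro laplace_mgf_le s_pos) auto
      also have "\<dots> \<le> ennreal (exp (2 * (l * s n)\<^sup>2))"
        using ls s_pos[of i] s_pos[of n] i
        by (intro ennreal_leI) (auto simp: abs_mult abs_le_square_iff[symmetric])
      finally show ?thesis using True by (simp add: g_def)
    next
      case False
      interpret prob_space "laplace (s i)" using i by (intro prob_space_laplace s_pos) auto
      show ?thesis using False emeasure_space_1 by (simp add: g_def)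
    qed
  qed auto
  also have "\<dots> = ennreal (exp (\<Sum>i = 1..n. 2 * \<bar>l\<bar> * u * B i powr (- v) + (if i \<in> ?A then 2 * (l * s n)\<^sup>2 else 0)))"
    by (simp add: exp_sum prod_ennreal flip: ennreal_mult exp_add)
  also have "(\<Sum>i = 1..n. 2 * \<bar>l\<bar> * u * B i powr (- v) + (if i \<in> ?A then 2 * (l * s n)\<^sup>2 else 0))
      = 2 * \<bar>l\<bar> * u * (\<Sum>i = 1..n. B i powr (- v)) + 2 * real (card ?A) * (l * s n)\<^sup>2"
    using A by (simp add: sum.distrib sum_distrib_left sum.inter_restrict[symmetric] Int_absorb1)
  finally show ?thesis .
qed

section \<open>Bias, noise scale and confidence width\<close>

abbreviation "width t n \<equiv> 18 * u powr (1 / (1 + v))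
       * (log b (2 * real t ^ 4) * L powr (1.5 + 1 / v) / (real n * \<epsilon>)) powr (v / (1 + v))"

text \<open>The common factor of the truncation bias, the noise scale per item and the width. Once
  it is factored out, only powers of logarithms remain to be compared.\<close>

abbreviation "U n \<equiv> u powr (1 / (1 + v)) * (\<epsilon> * real n) powr - (v / (1 + v))"

lemma u_powr: "u powr - (v / (1 + v)) * u = u powr (1 / (1 + v))"
proof -
  have "u powr - (v / (1 + v)) * u powr 1 = u powr (- (v / (1 + v)) + 1)" by (rule powr_add[symmetric])
  also have "- (v / (1 + v)) + 1 = 1 / (1 + v)" using v by (simp add: field_simps)
  finally show ?thesis using u by simp
qed

lemma bias_eq:
  assumes "1 \<le> n" shows "u * B n powr (- v) = U n * L powr (1.5 * (v / (1 + v)))"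
proof -
  have "B n powr (- v) = (\<epsilon> * u * real n / L powr 1.5) powr (- (v / (1 + v)))"
    by (simp add: trunc_level_def powr_powr)
  also have "\<dots> = (u * (\<epsilon> * real n)) powr (- (v / (1 + v))) / L powr (1.5 * - (v / (1 + v)))"
    using eps u by (simp add: powr_divide powr_powr mult_ac)
  also have "\<dots> = u powr - (v / (1 + v)) * (\<epsilon> * real n) powr (- (v / (1 + v))) * L powr (1.5 * (v / (1 + v)))"
    using eps u L_pos by (simp add: powr_mult powr_minus field_simps)
  finally have "u * B n powr (- v)
      = (u powr - (v / (1 + v)) * u) * (\<epsilon> * real n) powr (- (v / (1 + v))) * L powr (1.5 * (v / (1 + v)))"
    by (simp add: mult_ac)
  then show ?thesis by (simp only: u_powr)
qed

lemma noise_eq: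
  assumes "1 \<le> n" shows "s n / real n = U n * (2 * L powr (1 - 1.5 / (1 + v)))"
proof -
  have n: "0 < \<epsilon> * real n" using eps assms by simp
  have "B n = (u * (\<epsilon> * real n)) powr (1 / (1 + v)) / L powr (1.5 * (1 / (1 + v)))"
    using eps u unfolding trunc_level_def by (simp add: powr_divide powr_powr mult_ac)
  also have "\<dots> = u powr (1 / (1 + v)) * (\<epsilon> * real n) powr (1 / (1 + v)) * L powr - (1.5 / (1 + v))"
    using eps u by (simp add: powr_mult powr_minus field_simps)
  finally have "s n / real n = 2 * u powr (1 / (1 + v)) * ((\<epsilon> * real n) powr (1 / (1 + v)) / (\<epsilon> * real n))
      * (L * L powr - (1.5 / (1 + v)))"
    using eps assms by (simp add: noise_scale_def field_simps)
  also have "(\<epsilon> * real n) powr (1 / (1 + v)) / (\<epsilon> * real n) = (\<epsilon> * real n) powr (1 / (1 + v) - 1)"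
    using n by (simp add: powr_diff)
  also have "1 / (1 + v) - 1 = - (v / (1 + v))" using v by (simp add: field_simps)
  also have "L * L powr - (1.5 / (1 + v)) = L powr (1 - 1.5 / (1 + v))"
    using L_pos by (simp add: powr_diff powr_minus field_simps)
  finally show ?thesis by (simp add: mult_ac)
qed

lemma log_pos: "1 \<le> t \<Longrightarrow> 0 < log b (2 * real t ^ 4)"
proof -
  assume "1 \<le> t"
  then have "1 \<le> real t ^ 4" by simp
  then have "1 < 2 * real t ^ 4" by linarith
  then show ?thesis using b by (intro zero_less_log_cancel_iff[THEN iffD2]) linarith+
qed

lemma width_eq:
  "width t n = U n * (18 * log b (2 * real t ^ 4) powr (v / (1 + v)) * L powr ((1.5 + 1 / v) * (v / (1 + v))))"
  by (simp add: powr_divide powr_mult powr_powr powr_minus_divide mult_ac)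

lemma log_t_le:
  assumes "1 \<le> t" "t \<le> T"
  shows "log b (2 * real t ^ 4) \<le> 5 * L"
proof -
  \<comment> \<open>The factor 2 is absorbed by \<open>T \<ge> 2\<close>, which costs a fifth power
    of \<open>T\<close>.\<close>
  have "2 * real t ^ 4 \<le> real T * real T ^ 4" using assms T by (intro mult_mono power_mono) auto
  also have "\<dots> = real T ^ 5" by (simp add: power_numeral_reduce)
  finally have "log b (2 * real t ^ 4) \<le> log b (real T ^ 5)"
    using b T assms by (intro log_mono) auto
  also have "\<dots> = 5 * L" using T by (simp add: log_nat_power)
  finally show ?thesis .
qed

text \<open>The summands are proportional to \<open>i powr - p\<close> with
  \<open>p = v / (1 + v) \<le> 1 / 2\<close>, hence at most \<open>sqrt (n / i)\<close> times the
  last one. The sum of the inverse square roots then gives the factor \<open>2 * n\<close>.\<close>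

lemma sum_B_powr_le:
  assumes "1 \<le> n"
  shows "(\<Sum>i = 1..n. B i powr (- v)) \<le> 2 * real n * B n powr (- v)"
proof -
  let ?p = "v / (1 + v)" and ?x = "\<epsilon> * u / L powr 1.5"
  have x: "0 < ?x" using eps u L_pos by simp
  have p: "0 < ?p" "?p \<le> 1 / 2" using v by (auto simp: field_simps)
  have Bp: "B i powr (- v) = ?x powr - ?p * real i powr - ?p" for i
  proof -
    have "B i powr (- v) = (?x * real i) powr - ?p" by (simp add: trunc_level_def powr_powr)
    also have "\<dots> = ?x powr - ?p * real i powr - ?p" by (rule powr_mult)
    finally show ?thesis .
  qed
  have "real i powr - ?p \<le> real n powr - ?p * (sqrt (real n) * (1 / sqrt (real i)))" if "i \<in> {1..n}" for i
  proof -
    have i: "1 \<le> i" "i \<le> n" using that by auto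
    have "(real n / real i) powr ?p \<le> (real n / real i) powr (1 / 2)"
      using i p by (intro powr_mono) auto
    then have "real n powr - ?p * (real n powr ?p / real i powr ?p) \<le> real n powr - ?p * (sqrt (real n) / sqrt (real i))"
      using i by (intro mult_left_mono) (auto simp: powr_divide powr_half_sqrt)
    then show ?thesis using i by (simp add: powr_minus field_simps)
  qed
  then have "(\<Sum>i = 1..n. real i powr - ?p) \<le> (\<Sum>i = 1..n. real n powr - ?p * (sqrt (real n) * (1 / sqrt (real i))))"
    by (rule sum_mono)
  also have "\<dots> = real n powr - ?p * (sqrt (real n) * (\<Sum>i = 1..n. 1 / sqrt (real i)))"
    by (simp only: sum_distrib_left)
  also have "\<dots> \<le> real n powr - ?p * (sqrt (real n) * (2 * sqrt (real n)))"
    by (intro mult_left_mono sum_inverse_sqrt_le) auto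
  finally have "(\<Sum>i = 1..n. real i powr - ?p) \<le> 2 * real n * real n powr - ?p" by (simp add: mult_ac flip: mult.assoc)
  then have "?x powr - ?p * (\<Sum>i = 1..n. real i powr - ?p) \<le> ?x powr - ?p * (2 * real n * real n powr - ?p)"
    by (intro mult_left_mono) auto
  then show ?thesis unfolding Bp sum_distrib_left[symmetric] by (simp add: mult_ac)
qed

text \<open>Markov's inequality for the exponential; \<open>\<sigma>\<close> is a sign, so that both
  tails are covered at once. The 4 combines the 2 of the moment generating function with the 2 of
  \<open>sum_B_powr_le\<close>.\<close>

lemma private_sum_tail:
  assumes a: "a \<in> {1..K}" and n: "1 \<le> n" "n \<le> T" and \<sigma>: "\<bar>\<sigma>\<bar> = 1" and l: "0 < l"
    and ls: "l * s n \<le> 1 / 2" and lB: "l * B n \<le> 1"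
  shows "M.prob {\<omega> \<in> space M. r \<le> \<sigma> * (S \<omega> a n - n * \<mu> a)}
    \<le> exp (4 * l * u * n * B n powr (- v) + 2 * real (card (noise_items n)) * (l * s n)\<^sup>2 - l * r)"
proof -
  let ?E = "{\<omega> \<in> space M. r \<le> \<sigma> * (S \<omega> a n - n * \<mu> a)}"
  have "emeasure M ?E = (\<integral>\<^sup>+\<omega>. indicator ?E \<omega> \<partial>M)" by (rule nn_integral_indicator[symmetric]) measurable
  also have "\<dots> \<le> (\<integral>\<^sup>+\<omega>. ennreal (exp (- l * r)) * ennreal (exp (\<sigma> * l * (S \<omega> a n - n * \<mu> a))) \<partial>M)"
  proof (rule nn_integral_mono)
    fix \<omega>
    have "1 \<le> exp (- l * r) * exp (\<sigma> * l * (S \<omega> a n - n * \<mu> a))" if "\<omega> \<in> ?E"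
    proof -
      have "l * r \<le> l * (\<sigma> * (S \<omega> a n - n * \<mu> a))" using that l by (intro mult_left_mono) auto
      then show ?thesis by (simp add: mult_ac flip: exp_add)
    qed
    then show "indicator ?E \<omega> \<le> ennreal (exp (- l * r)) * ennreal (exp (\<sigma> * l * (S \<omega> a n - n * \<mu> a)))"
      by (auto split: split_indicator simp flip: ennreal_mult)
  qed
  also have "\<dots> = ennreal (exp (- l * r)) * (\<integral>\<^sup>+\<omega>. ennreal (exp (\<sigma> * l * (S \<omega> a n - n * \<mu> a))) \<partial>M)"
    by (rule nn_integral_cmult) measurable
  also have "\<dots> \<le> ennreal (exp (- l * r)) *
      ennreal (exp (2 * l * u * (\<Sum>i = 1..n. B i powr (- v)) + 2 * real (card (noise_items n)) * (l * s n)\<^sup>2))"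
    using private_sum_mgf[OF a n, of "\<sigma> * l"] \<sigma> l ls lB
    by (intro mult_left_mono) (auto simp: abs_mult power_mult_distrib abs_square_eq_1[THEN iffD2])
  also have "\<dots> \<le> ennreal (exp (- l * r)) *
      ennreal (exp (2 * l * u * (2 * real n * B n powr (- v)) + 2 * real (card (noise_items n)) * (l * s n)\<^sup>2))"
    using sum_B_powr_le[OF n(1)] l u
    by (intro mult_left_mono ennreal_leI) (auto intro!: mult_left_mono)
  also have "\<dots> = ennreal (exp (4 * l * u * n * B n powr (- v) + 2 * real (card (noise_items n)) * (l * s n)\<^sup>2 - l * r))"
    by (simp add: algebra_simps flip: ennreal_mult exp_add)
  finally show ?thesis unfolding M.emeasure_eq_measure by (subst (asm) ennreal_le_iff) auto
qed

lemma confidence: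
  assumes a: "a \<in> {1..K}" and n: "1 \<le> n" "n \<le> t" "t \<le> T" and \<sigma>: "\<bar>\<sigma>\<bar> = 1"
    and c: "c = min 1 (log b 2)" and big: "2 / c\<^sup>2 \<le> L powr (1 / 4)" "2 * ln b \<le> L powr (1 / 4)"
  shows "M.prob {\<omega> \<in> space M. n * width t n \<le> \<sigma> * (S \<omega> a n - n * \<mu> a)} \<le> 1 / (2 * real t ^ 4)"
proof -
  define w where "w = L powr (1 / 4)"
  define l where "l = 1 / (s n * w)"
  define k where "k = real (card (noise_items n))"
  let ?l = "log b (2 * real t ^ 4)"
  note sp = s_pos[OF n(1)]
  have c0: "0 < c" "c \<le> 1" using c b by auto
  have "1 \<le> 1 / c\<^sup>2" using c0 by (simp add: power_le_one)
  then have w2: "2 \<le> w" using big(1) by (simp add: w_def)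
  have L1: "1 \<le> L"
  proof (rule ccontr)
    assume "\<not> 1 \<le> L"
    then have "L powr (1 / 4) \<le> 1 powr (1 / 4)" using L_pos by (intro powr_mono2) auto
    then show False using w2 by (simp add: w_def)
  qed
  have l0: "0 < l" using sp w2 by (simp add: l_def)
  have ls: "l * s n = 1 / w" using sp by (simp add: l_def)
  \<comment> \<open>By definition \<open>s n\<close> is \<open>B n\<close> times
    \<open>2 * L / \<epsilon>\<close>, and this factor exceeds 1 since \<open>L \<ge> 1\<close> and
    \<open>\<epsilon> \<le> 1\<close>.\<close>
  have lB: "l * B n \<le> 1"
  proof -
    have "1 * (B n * 1) \<le> w * (B n * (2 * L / \<epsilon>))"
      using w2 B_pos[OF n(1)] L1 eps by (intro mult_mono) (auto simp: divide_simps)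
    also have "\<dots> = s n * w" by (simp add: noise_scale_def)
    finally show ?thesis using sp w2 by (simp add: l_def divide_le_eq)
  qed
  have t1: "1 \<le> real t ^ 4" using n by simp
  have lc: "c \<le> ?l"
  proof -
    have "log b 2 \<le> ?l" using b t1 by (intro log_mono) auto
    then show ?thesis using c by simp
  qed
  have kL: "k \<le> 2 * L / c"
  proof -
    have "k \<le> log 2 (real n) + 1" unfolding k_def using n by (intro card_noise_items) auto
    \<comment> \<open>The additional node is absorbed because \<open>T \<ge> 2\<close> gives
      \<open>1 \<le> log 2 T\<close>.\<close>
    also have "\<dots> \<le> log 2 (real T) + log 2 (real T)" using n T by (intro add_mono log_mono) auto
    also have "log 2 (real T) = L / log b 2" using b by (simp add: log_base_change[of b 2])
    also have "\<dots> \<le> L / c" using c0 c L1 by (intro divide_left_mono) auto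
    finally show ?thesis by (simp add: c)
  qed
  have main: "4 * L powr (1.5 * (v / (1 + v))) + (2 * k / w + ln b * ?l * w) * (2 * L powr (1 - 1.5 / (1 + v)))
      \<le> 18 * ?l powr (v / (1 + v)) * L powr ((1.5 + 1 / v) * (v / (1 + v)))"
    using n b big c0 lc kL L1 v by (intro width_dominates[where c = c] log_t_le) (auto simp: w_def)
  have "4 * (u * B n powr (- v)) + (2 * k / w + ln b * ?l * w) * (s n / real n) \<le> width t n"
  proof -
    have "4 * (u * B n powr (- v)) + (2 * k / w + ln b * ?l * w) * (s n / real n)
       = U n * (4 * L powr (1.5 * (v / (1 + v))) + (2 * k / w + ln b * ?l * w) * (2 * L powr (1 - 1.5 / (1 + v))))"
      unfolding bias_eq[OF n(1)] noise_eq[OF n(1)] by (simp only: distrib_left mult_ac)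
    also have "\<dots> \<le> width t n"
      unfolding width_eq by (intro mult_left_mono main) auto
    finally show ?thesis .
  qed
  \<comment> \<open>Scaling by \<open>l * n\<close> turns the comparison of widths into one of
    Chernoff exponents: as \<open>l * s n = 1 / w\<close>, the second term becomes the variance and
    the third becomes \<open>ln (2 * t ^ 4)\<close>.\<close>
  then have "l * n * (4 * (u * B n powr (- v)) + (2 * k / w + ln b * ?l * w) * (s n / real n)) \<le> l * n * width t n"
    using l0 by (intro mult_left_mono) auto
  also have "l * n * (4 * (u * B n powr (- v)) + (2 * k / w + ln b * ?l * w) * (s n / real n))
      = 4 * l * u * n * B n powr (- v) + (2 * k / w + ln b * ?l * w) * (l * s n)"
    using n by (simp add: field_simps)
  also have "(2 * k / w + ln b * ?l * w) * (l * s n) = 2 * k * (l * s n)\<^sup>2 + ln b * ?l"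
    unfolding ls using w2 by (simp add: field_simps power2_eq_square)
  also have "ln b * ?l = ln (2 * real t ^ 4)" using b by (simp add: log_def)
  finally have expo: "4 * l * u * n * B n powr (- v) + 2 * k * (l * s n)\<^sup>2 - l * (n * width t n) \<le> - ln (2 * real t ^ 4)"
    by simp
  have "M.prob {\<omega> \<in> space M. n * width t n \<le> \<sigma> * (S \<omega> a n - n * \<mu> a)}
      \<le> exp (4 * l * u * n * B n powr (- v) + 2 * k * (l * s n)\<^sup>2 - l * (n * width t n))"
    unfolding k_def by (rule private_sum_tail[OF a n(1) _ \<sigma> l0 _ lB]) (use n w2 in \<open>auto simp: ls\<close>)
  also have "\<dots> \<le> exp (- ln (2 * real t ^ 4))" using expo by simp
  also have "\<dots> = 1 / (2 * real t ^ 4)" 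
    unfolding exp_minus using t1 by (subst exp_ln) (linarith, simp add: inverse_eq_divide)
  finally show ?thesis .
qed

section \<open>Pull counts and regret\<close>

abbreviation "pick \<equiv> choose_arm b \<epsilon> v u K T tie"
abbreviation "cnt \<equiv> pulls b \<epsilon> v u K T tie"
abbreviation "idx \<equiv> ucb_index b \<epsilon> v u T"

lemma pick_maximizer:
  assumes "K < t"
  shows "pick \<omega> t N \<in> {a \<in> {1..K}. \<forall>c\<in>{1..K}. idx \<omega> t N c \<le> idx \<omega> t N a}"
proof -
  let ?A = "{a. is_arg_max (idx \<omega> t N) (\<lambda>a. a \<in> {1..K}) a}"
  have "?A \<noteq> {}" using K by (intro is_arg_max_set_nonempty) auto
  moreover have "?A \<subseteq> {1..K}" unfolding is_arg_max_set_eq by auto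
  ultimately have "tie t ?A \<in> ?A" using tie unfolding tie_rule_def by blast
  then show ?thesis using assms unfolding choose_arm_def is_arg_max_set_eq by simp
qed

lemma pick_in: "1 \<le> t \<Longrightarrow> pick \<omega> t N \<in> {1..K}"
  using pick_maximizer[of t \<omega> N] by (cases "t \<le> K") (auto simp: choose_arm_def)

lemma cnt_Suc:
  "cnt \<omega> (Suc t) = (cnt \<omega> t)(pick \<omega> (Suc t) (cnt \<omega> t) := cnt \<omega> t (pick \<omega> (Suc t) (cnt \<omega> t)) + 1)"
  by (simp add: Let_def)

declare pulls.simps(2) [simp del]

lemma cnt_Suc_apply:
  "cnt \<omega> (Suc t) a = (if pick \<omega> (Suc t) (cnt \<omega> t) = a then cnt \<omega> t a + 1 else cnt \<omega> t a)"
  by (simp add: cnt_Suc)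

lemma cnt_mono_Suc: "cnt \<omega> t a \<le> cnt \<omega> (Suc t) a"
  by (simp add: cnt_Suc)

lemma cnt_le: "cnt \<omega> t a \<le> t"
proof (induction t)
  case (Suc t)
  then show ?case by (simp add: cnt_Suc_apply)
qed simp

lemma sum_cnt: "(\<Sum>a = 1..K. cnt \<omega> t a) = t"
proof (induction t)
  case (Suc t)
  let ?c = "pick \<omega> (Suc t) (cnt \<omega> t)"
  have "(\<Sum>a = 1..K. cnt \<omega> (Suc t) a) = (\<Sum>a = 1..K. cnt \<omega> t a + (if a = ?c then 1 else 0))"
    by (rule sum.cong) (auto simp: cnt_Suc)
  then show ?case using Suc pick_in[of "Suc t" \<omega> "cnt \<omega> t"] by (simp add: sum.distrib)
qed simp

lemma cnt_initial: "t \<le> K \<Longrightarrow> cnt \<omega> t a = (if 1 \<le> a \<and> a \<le> t then 1 else 0)"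
proof (induction t)
  case (Suc t)
  then have "pick \<omega> (Suc t) (cnt \<omega> t) = Suc t" by (simp add: choose_arm_def)
  then show ?case using Suc by (simp add: cnt_Suc_apply)
qed simp

lemma cnt_pos:
  assumes "a \<in> {1..K}" "K \<le> t" shows "1 \<le> cnt \<omega> t a"
  using assms(2)
proof (induction t rule: dec_induct)
  case base
  then show ?case using assms(1) cnt_initial[of K \<omega> a] by simp
next
  case (step t)
  then show ?case using cnt_mono_Suc[of \<omega> t a] by simp
qed

section \<open>Measurability of the pull counters\<close>

text \<open>The tie rule is an arbitrary function of the set of maximizers, so measurability goes
  through this set, which takes finitely many values. The counters \<open>N\<close> are held fixed
  here.\<close>

lemma measurable_pick: "(\<lambda>\<omega>. pick \<omega> t N) \<in> measurable M (count_space UNIV)"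
proof (cases "t \<le> K")
  case True
  then show ?thesis by (simp add: choose_arm_def)
next
  case False
  define A where "A \<omega> = {a \<in> {1..K}. \<forall>c\<in>{1..K}. idx \<omega> t N c \<le> idx \<omega> t N a}" for \<omega>
  have [measurable]: "(\<lambda>\<omega>. idx \<omega> t N a) \<in> borel_measurable M" for a
    unfolding ucb_index_def by measurable
  have [measurable]: "Measurable.pred M (\<lambda>\<omega>. idx \<omega> t N c \<le> idx \<omega> t N a)" for a c
    unfolding pred_def by (rule borel_measurable_le) measurable
  have "A \<in> measurable M (count_space (Pow {1..K}))"
  proof (subst measurable_count_space_eq2, simp, intro conjI ballI)
    show "A \<in> space M \<rightarrow> Pow {1..K}" by (auto simp: A_def)
    fix X assume "X \<in> Pow {1..K}"
    then have "A \<omega> = X \<longleftrightarrow> (\<forall>a\<in>{1..K}. (a \<in> X) = (\<forall>c\<in>{1..K}. idx \<omega> t N c \<le> idx \<omega> t N a))" for \<omega>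
      unfolding A_def by blast
    then have "A -` {X} \<inter> space M = {\<omega> \<in> space M. \<forall>a\<in>{1..K}.
        (a \<in> X) = (\<forall>c\<in>{1..K}. idx \<omega> t N c \<le> idx \<omega> t N a)}"
      by auto
    also have "\<dots> \<in> sets M" by measurable
    finally show "A -` {X} \<inter> space M \<in> sets M" .
  qed
  then have "(\<lambda>\<omega>. tie t (A \<omega>)) \<in> measurable M (count_space UNIV)"
    by (rule measurable_compose) simp
  then show ?thesis using False unfolding choose_arm_def is_arg_max_set_eq A_def by simp
qed

text \<open>The counters form a random function. Its values stay in a countable set, so the next
  step can be treated for each value of the counters separately.\<close>

lemma measurable_cnt_fun: "(\<lambda>\<omega>. cnt \<omega> t) \<in> measurable M (count_space (range count_list))"
proof (induction t)
  case 0
  have "(\<lambda>_. 0 :: nat) = count_list ([] :: nat list)" by auto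
  then have "(\<lambda>_. 0 :: nat) \<in> range (count_list :: nat list \<Rightarrow> _)" by (rule range_eqI)
  then show ?case by simp
next
  case (Suc t)
  define f where "f N \<omega> = N(pick \<omega> (Suc t) N := N (pick \<omega> (Suc t) N) + 1)" for N \<omega>
  have "(\<lambda>\<omega>. f (cnt \<omega> t) \<omega>) \<in> measurable M (count_space (range count_list))"
  proof (rule measurable_compose_countable'[OF _ Suc])
    fix N :: "nat \<Rightarrow> nat" assume "N \<in> range count_list"
    then obtain xs where xs: "N = count_list xs" by auto
    have "(\<lambda>a. N(a := N a + 1)) \<in> measurable (count_space UNIV) (count_space (range count_list))"
      unfolding xs count_list_Cons[symmetric] by simp
    from measurable_compose[OF measurable_pick this]
    show "(\<lambda>\<omega>. f N \<omega>) \<in> measurable M (count_space (range count_list))" unfolding f_def .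
  qed simp
  then show ?case unfolding f_def cnt_Suc .
qed

lemma measurable_cnt [measurable]: "(\<lambda>\<omega>. cnt \<omega> t a) \<in> measurable M (count_space UNIV)"
  by (rule measurable_compose[OF measurable_cnt_fun]) simp

section \<open>Independence of rewards and pull counts, regret decomposition\<close>

lemma private_sum_cong:
  assumes "\<And>m. m \<le> n \<Longrightarrow> \<omega> (a, m) = \<omega>' (a, m)"
  shows "S \<omega> a n = S \<omega>' a n"
  unfolding private_sum_eq arm_stream_def Let_def
  using assms noise_items_subset[of n] by (intro arg_cong2[where f = "(+)"] sum.cong) auto

text \<open>This lemma implies that the event \<open>n \<le> cnt w T a\<close> does not depend on the table entry \<open>(a, n)\<close>.\<close>

lemma cnt_fun_upd:
  "cnt (w((a, n) := x)) t = cnt w t \<or> n \<le> cnt w t a \<and> n \<le> cnt (w((a, n) := x)) t a"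
proof (induction t)
  case (Suc t)
  define w' where "w' = w((a, n) := x)"
  have upd: "w' p = w p" if "p \<noteq> (a, n)" for p using that by (simp add: w'_def)
  have IH: "cnt w' t = cnt w t \<or> n \<le> cnt w t a \<and> n \<le> cnt w' t a"
    unfolding w'_def by (rule Suc.IH)
  have "cnt w' (Suc t) = cnt w (Suc t) \<or> n \<le> cnt w (Suc t) a \<and> n \<le> cnt w' (Suc t) a"
  proof (cases "n \<le> cnt w t a \<and> n \<le> cnt w' t a")
    case True
    then show ?thesis using cnt_mono_Suc[of w t a] cnt_mono_Suc[of w' t a] by linarith
  next
    case False
    then have eq: "cnt w' t = cnt w t" using IH by blast
    \<comment> \<open>Fewer than \<open>n\<close> pulls of \<open>a\<close> have been made, so the
      indices have not read the altered entry and both runs choose the same arm.\<close>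
    then have less: "cnt w t a < n" using False by simp
    have "S w' c (cnt w t c) = S w c (cnt w t c)" for c
      by (rule private_sum_cong, rule upd) (use less in auto)
    then have "idx w' (Suc t) (cnt w t) = idx w (Suc t) (cnt w t)"
      by (simp add: ucb_index_def fun_eq_iff)
    then have "pick w' (Suc t) (cnt w t) = pick w (Suc t) (cnt w t)"
      by (simp add: choose_arm_def)
    then show ?thesis by (simp add: cnt_Suc eq)
  qed
  then show ?case unfolding w'_def .
qed simp

lemma sum_rewards:
  "(\<Sum>t = 1..m. reward_at b \<epsilon> v u K T tie \<omega> t) = (\<Sum>a = 1..K. \<Sum>n = 1..cnt \<omega> m a. fst (\<omega> (a, n)))"
proof (induction m)
  case (Suc m)
  let ?c = "pick \<omega> (Suc m) (cnt \<omega> m)"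
  \<comment> \<open>\<open>reward_at\<close> reads the counter after the pull, so the new reward has
    index \<open>cnt \<omega> m ?c + 1\<close>.\<close>
  have "(\<Sum>a = 1..K. \<Sum>n = 1..cnt \<omega> (Suc m) a. fst (\<omega> (a, n)))
      = (\<Sum>a = 1..K. (\<Sum>n = 1..cnt \<omega> m a. fst (\<omega> (a, n))) + (if a = ?c then fst (\<omega> (?c, cnt \<omega> m ?c + 1)) else 0))"
    by (rule sum.cong) (auto simp: cnt_Suc)
  also have "\<dots> = (\<Sum>a = 1..K. \<Sum>n = 1..cnt \<omega> m a. fst (\<omega> (a, n))) + fst (\<omega> (?c, cnt \<omega> m ?c + 1))"
    using pick_in[of "Suc m" \<omega> "cnt \<omega> m"] by (simp add: sum.distrib)
  finally show ?case
    using Suc by (simp add: reward_at_def arm_at_def Let_def cnt_Suc)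
qed simp

text \<open>Whether arm \<open>a\<close> is pulled at least \<open>n\<close> times is settled before
  its \<open>n\<close>-th entry is read, so the indicator is independent of the reward.\<close>

lemma expected_reward:
  assumes a: "a \<in> {1..K}" and n: "n \<in> {1..T}"
  shows "integrable M (\<lambda>\<omega>. fst (\<omega> (a, n)) * of_bool (n \<le> cnt \<omega> T a))"
    and "(\<integral>\<omega>. fst (\<omega> (a, n)) * of_bool (n \<le> cnt \<omega> T a) \<partial>M) = \<mu> a * (\<integral>\<omega>. of_bool (n \<le> cnt \<omega> T a) \<partial>M)"
proof -
  have p: "(a, n) \<in> entries" using a n by auto
  interpret lap: prob_space "laplace (s n)" using n by (intro prob_space_laplace s_pos) auto
  have iD: "integrable (D a) (\<lambda>x. x)" using heavy_tailed_integrable_id[OF ht[OF a]] v by simp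
  have d: "distr (D a \<Otimes>\<^sub>M laplace (s n)) (D a) fst = D a" by (rule lap.distr_pair_fst)
  have i1: "integrable (entry (a, n)) fst"
    using integrable_distr[of fst "D a \<Otimes>\<^sub>M laplace (s n)" "D a" "\<lambda>x. x"] d iD by simp
  have i2: "(\<integral>x. fst x \<partial>entry (a, n)) = \<mu> a"
    using integral_distr[of fst "D a \<Otimes>\<^sub>M laplace (s n)" "D a" "\<lambda>x. x"] d iD by simp
  have h: "(\<lambda>\<omega>. of_bool (n \<le> cnt \<omega> T a) :: real) \<in> borel_measurable (Pi\<^sub>M entries entry)"
    unfolding M_eq[symmetric] by measurable
  have inv: "of_bool (n \<le> cnt (w((a, n) := x)) T a) = (of_bool (n \<le> cnt w T a) :: real)" for w x
    using cnt_fun_upd[of w a n x T] by auto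
  note indep = integral_PiM_mult_indep[of entries "(a, n)" entry fst "\<lambda>\<omega>. of_bool (n \<le> cnt \<omega> T a)" 1,
      OF _ p prob_entry i1 h _ inv]
  show "integrable M (\<lambda>\<omega>. fst (\<omega> (a, n)) * of_bool (n \<le> cnt \<omega> T a))"
    unfolding M_eq by (rule indep(1)) auto
  show "(\<integral>\<omega>. fst (\<omega> (a, n)) * of_bool (n \<le> cnt \<omega> T a) \<partial>M) = \<mu> a * (\<integral>\<omega>. of_bool (n \<le> cnt \<omega> T a) \<partial>M)"
    unfolding M_eq i2[symmetric] by (rule indep(2)) auto
qed

abbreviation "mean_cnt a \<equiv> \<integral>\<omega>. real (cnt \<omega> T a) \<partial>M"

lemma integrable_cnt: "integrable M (\<lambda>\<omega>. real (cnt \<omega> T a))"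
  by (rule M.integrable_const_bound[where B = "real T"]) (auto simp: cnt_le)

text \<open>A sum of a random number of rewards is rewritten as a sum up to \<open>T\<close> with
  indicators, whose terms factor in expectation. The benchmark term is split in the same way because
  the pull counts add up to \<open>T\<close>.\<close>

lemma regret_eq: "expected_regret b \<epsilon> v u K T tie D = (\<Sum>a = 1..K. gap K D a * mean_cnt a)"
proof -
  define h where "h a n \<omega> = (of_bool (n \<le> cnt \<omega> T a) :: real)" for a n \<omega>
  have restrict: "(\<Sum>n = 1..cnt \<omega> T a. f n) = (\<Sum>n = 1..T. f n * h a n \<omega>)" for a \<omega> and f :: "nat \<Rightarrow> real"
    using cnt_le[of \<omega> T a] unfolding h_def by (intro sum.mono_neutral_cong_left) auto
  have ih: "integrable M (h a n)" for a n
    unfolding h_def by (rule M.integrable_const_bound[where B = 1]) auto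
  note reward = expected_reward[folded h_def]
  have "(\<integral>\<omega>. (\<Sum>t = 1..T. reward_at b \<epsilon> v u K T tie \<omega> t) \<partial>M)
      = (\<integral>\<omega>. (\<Sum>a = 1..K. \<Sum>n = 1..T. fst (\<omega> (a, n)) * h a n \<omega>) \<partial>M)"
    unfolding sum_rewards restrict ..
  also have "\<dots> = (\<Sum>a = 1..K. \<integral>\<omega>. (\<Sum>n = 1..T. fst (\<omega> (a, n)) * h a n \<omega>) \<partial>M)"
    by (intro Bochner_Integration.integral_sum Bochner_Integration.integrable_sum reward)
  also have "\<dots> = (\<Sum>a = 1..K. \<Sum>n = 1..T. \<integral>\<omega>. fst (\<omega> (a, n)) * h a n \<omega> \<partial>M)"
    by (intro sum.cong refl Bochner_Integration.integral_sum reward)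
  also have "\<dots> = (\<Sum>a = 1..K. \<Sum>n = 1..T. \<mu> a * (\<integral>\<omega>. h a n \<omega> \<partial>M))"
    by (intro sum.cong refl reward)
  also have "\<dots> = (\<Sum>a = 1..K. \<mu> a * (\<integral>\<omega>. (\<Sum>n = 1..T. h a n \<omega>) \<partial>M))"
    by (subst Bochner_Integration.integral_sum) (auto simp: ih sum_distrib_left)
  also have "\<dots> = (\<Sum>a = 1..K. \<mu> a * mean_cnt a)"
    using restrict[of "\<lambda>_. 1", symmetric] by simp
  finally have 1: "(\<integral>\<omega>. (\<Sum>t = 1..T. reward_at b \<epsilon> v u K T tie \<omega> t) \<partial>M) = (\<Sum>a = 1..K. \<mu> a * mean_cnt a)" .
  have "(\<Sum>a = 1..K. mean_cnt a) = (\<integral>\<omega>. (\<Sum>a = 1..K. real (cnt \<omega> T a)) \<partial>M)"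
    by (rule Bochner_Integration.integral_sum[symmetric]) (rule integrable_cnt)
  also have "\<dots> = real T" unfolding of_nat_sum[symmetric] sum_cnt by (simp add: M.prob_space)
  finally have "real T * best_mean K D = (\<Sum>a = 1..K. best_mean K D * mean_cnt a)"
    by (simp add: mult.commute flip: sum_distrib_left)
  then show ?thesis
    unfolding expected_regret_def 1 gap_def left_diff_distrib sum_subtractf by simp
qed

section \<open>Bounding the pulls of a suboptimal arm\<close>

lemma gap_nonneg: "a \<in> {1..K} \<Longrightarrow> 0 \<le> gap K D a"
  unfolding gap_def best_mean_def by simp

lemma best_arm: obtains a where "a \<in> {1..K}" "\<mu> a = best_mean K D"
proof -
  have "best_mean K D \<in> (\<lambda>a. \<mu> a) ` {1..K}" unfolding best_mean_def using K by (intro Max_in) auto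
  then show ?thesis using that by auto
qed

text \<open>Solves \<open>gap K D a = 2 * width T n\<close> for \<open>n\<close>.\<close>

definition pull_bound :: "nat \<Rightarrow> real" where
  "pull_bound a = 36 powr ((1 + v) / v) * u powr (1 / v) * (log b (2 * real T ^ 4) * L powr (1.5 + 1 / v) / \<epsilon>)
     * gap K D a powr - ((1 + v) / v)"

lemma pull_bound_nonneg: "0 \<le> pull_bound a"
  unfolding pull_bound_def using eps log_pos[of T] T by simp

text \<open>After enlarging \<open>log b (2 * t ^ 4)\<close> to its value at \<open>T\<close>, the
  power \<open>(1 + v) / v\<close> makes the right-hand side linear in \<open>1 / n\<close>.\<close>

lemma le_pull_bound:
  assumes g: "0 < gap K D a" "gap K D a \<le> 2 * width t n" and n: "1 \<le> n" and t: "1 \<le> t" "t \<le> T"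
  shows "real n \<le> pull_bound a"
proof -
  let ?X = "log b (2 * real T ^ 4) * L powr (1.5 + 1 / v)" and ?p = "v / (1 + v)" and ?r = "(1 + v) / v"
  have lt: "log b (2 * real t ^ 4) \<le> log b (2 * real T ^ 4)"
    using b t by (intro log_mono mult_left_mono power_mono) auto
  have X: "0 < ?X" using log_pos[of T] T L_pos by simp
  have e: "0 < real n * \<epsilon>" using n eps by simp
  have "gap K D a \<le> 2 * width t n" by fact
  also have "\<dots> = 36 * u powr (1 / (1 + v)) * (log b (2 * real t ^ 4) * L powr (1.5 + 1 / v) / (real n * \<epsilon>)) powr ?p" by simp
  also have "\<dots> \<le> 36 * u powr (1 / (1 + v)) * (?X / (real n * \<epsilon>)) powr ?p"
    using lt log_pos[OF t(1)] e v by (intro mult_left_mono powr_mono2 divide_right_mono mult_right_mono) auto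
  finally have "gap K D a powr ?r \<le> (36 * u powr (1 / (1 + v)) * (?X / (real n * \<epsilon>)) powr ?p) powr ?r"
    using g v by (intro powr_mono2) auto
  also have "\<dots> = 36 powr ?r * u powr (1 / (1 + v) * ?r) * (?X / (real n * \<epsilon>)) powr (?p * ?r)"
    by (simp only: powr_mult powr_powr)
  also have "1 / (1 + v) * ?r = 1 / v" using v by simp
  also have "?p * ?r = 1" using v by simp
  also have "(?X / (real n * \<epsilon>)) powr 1 = ?X / \<epsilon> / real n" using X e by (simp add: mult.commute)
  finally have "gap K D a powr ?r \<le> 36 powr ?r * u powr (1 / v) * (?X / \<epsilon> / real n)" .
  then have "gap K D a powr ?r * real n \<le> 36 powr ?r * u powr (1 / v) * (?X / \<epsilon> / real n) * real n"
    by (rule mult_right_mono) simp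
  also have "\<dots> = 36 powr ?r * u powr (1 / v) * (?X / \<epsilon>)" using n by simp
  finally have "real n \<le> 36 powr ?r * u powr (1 / v) * (?X / \<epsilon>) / gap K D a powr ?r"
    using g by (simp only: pos_le_divide_eq powr_gt_zero mult.commute[of "real n"])
  then show ?thesis unfolding pull_bound_def powr_minus_divide by simp
qed

text \<open>The gap reduces the exponent \<open>- (1 + v) / v\<close> to \<open>- 1 / v\<close>, and
  \<open>log b (2 * T ^ 4) \<le> 5 * L\<close> raises the power of \<open>L\<close> from
  \<open>1.5 + 1 / v\<close> to \<open>2.5 + 1 / v\<close>.\<close>

lemma gap_mult_pull_bound:
  assumes g: "0 < gap K D a"
  shows "gap K D a * pull_bound a
    \<le> 5 * 36 powr ((1 + v) / v) * (L powr (2.5 + 1 / v) / \<epsilon> * (u / gap K D a) powr (1 / v))"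
proof -
  let ?g = "gap K D a"
  have "?g * ?g powr - ((1 + v) / v) = ?g powr (1 + - ((1 + v) / v))"
    using g by (simp only: powr_add powr_one)
  also have "1 + - ((1 + v) / v) = - (1 / v)" using v by (simp add: field_simps)
  finally have 1: "?g * ?g powr - ((1 + v) / v) = ?g powr - (1 / v)" .
  have "?g * pull_bound a = 36 powr ((1 + v) / v) * u powr (1 / v)
      * (log b (2 * real T ^ 4) * L powr (1.5 + 1 / v) / \<epsilon>) * (?g * ?g powr - ((1 + v) / v))"
    by (simp add: pull_bound_def)
  also have "\<dots> \<le> 36 powr ((1 + v) / v) * u powr (1 / v)
      * (5 * L * L powr (1.5 + 1 / v) / \<epsilon>) * (?g * ?g powr - ((1 + v) / v))"
    using eps g log_t_le[of T] T by (intro mult_right_mono mult_left_mono divide_right_mono) auto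
  also have "5 * L * L powr (1.5 + 1 / v) = 5 * L powr (1 + (1.5 + 1 / v))"
    using L_pos by (simp only: powr_add powr_one mult.assoc)
  also have "1 + (1.5 + 1 / v) = 2.5 + 1 / v" by simp
  also have "36 powr ((1 + v) / v) * u powr (1 / v) * (5 * L powr (2.5 + 1 / v) / \<epsilon>) * (?g * ?g powr - ((1 + v) / v))
      = 5 * 36 powr ((1 + v) / v) * (L powr (2.5 + 1 / v) / \<epsilon> * (u / ?g) powr (1 / v))"
    unfolding 1 by (simp add: powr_divide powr_minus_divide)
  finally show ?thesis .
qed

text \<open>Here \<open>a\<close> is the arm whose pulls are counted and \<open>c\<close> an optimal arm.\<close>

definition bad :: "nat \<Rightarrow> nat \<Rightarrow> nat \<Rightarrow> table set" where
  "bad a c t = (\<Union>n\<in>{1..t}. {\<omega> \<in> space M. n * width t n \<le> 1 * (S \<omega> a n - n * \<mu> a)}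
     \<union> {\<omega> \<in> space M. n * width t n \<le> - 1 * (S \<omega> c n - n * \<mu> c)})"

lemma sets_bad [measurable]: "bad a c t \<in> sets M"
  unfolding bad_def by measurable

lemma not_bad:
  assumes "\<omega> \<in> space M" "\<omega> \<notin> bad a c t" "n \<in> {1..t}"
  shows "S \<omega> a n / n < \<mu> a + width t n" "\<mu> c - width t n < S \<omega> c n / n"
proof -
  have n: "0 < real n" using assms(3) by simp
  have upper: "\<not> k * r \<le> 1 * (x - k * m) \<Longrightarrow> x < (m + r) * k"
    and lower: "\<not> k * r \<le> - 1 * (x - k * m) \<Longrightarrow> (m - r) * k < x" for k r x m :: real
    by (simp_all add: algebra_simps)
  have nb: "\<not> n * width t n \<le> 1 * (S \<omega> a n - n * \<mu> a)" "\<not> n * width t n \<le> - 1 * (S \<omega> c n - n * \<mu> c)"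
    using assms unfolding bad_def by blast+
  show "S \<omega> a n / n < \<mu> a + width t n"
    unfolding pos_divide_less_eq[OF n] by (rule upper[OF nb(1)])
  show "\<mu> c - width t n < S \<omega> c n / n"
    unfolding pos_less_divide_eq[OF n] by (rule lower[OF nb(2)])
qed

text \<open>The pull counts are random, so a union bound over all \<open>n \<le> t\<close> is taken.
  It costs a factor \<open>t\<close> and leaves \<open>1 / t ^ 3\<close>, which is weakened to a
  summable square.\<close>

lemma prob_bad:
  assumes a: "a \<in> {1..K}" and c: "c \<in> {1..K}" and t: "1 \<le> t" "t \<le> T"
    and big: "2 / (min 1 (log b 2))\<^sup>2 \<le> L powr (1 / 4)" "2 * ln b \<le> L powr (1 / 4)"
  shows "M.prob (bad a c t) \<le> 1 / (real t)\<^sup>2"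
proof -
  let ?E = "\<lambda>n. {\<omega> \<in> space M. n * width t n \<le> 1 * (S \<omega> a n - n * \<mu> a)}"
  let ?F = "\<lambda>n. {\<omega> \<in> space M. n * width t n \<le> - 1 * (S \<omega> c n - n * \<mu> c)}"
  have "M.prob (bad a c t) \<le> (\<Sum>n\<in>{1..t}. M.prob (?E n \<union> ?F n))"
    unfolding bad_def by (rule M.finite_measure_subadditive_finite) auto
  also have "\<dots> \<le> (\<Sum>n\<in>{1..t}. 1 / real t ^ 4)"
  proof (rule sum_mono)
    fix n assume n: "n \<in> {1..t}"
    have "M.prob (?E n \<union> ?F n) \<le> M.prob (?E n) + M.prob (?F n)"
      by (rule measure_Un_le) measurable
    also have "\<dots> \<le> 1 / (2 * real t ^ 4) + 1 / (2 * real t ^ 4)"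
      using n t by (intro add_mono confidence[OF _ _ _ _ _ refl big] a c) auto
    finally show "M.prob (?E n \<union> ?F n) \<le> 1 / real t ^ 4" by simp
  qed
  also have "\<dots> = 1 / real t ^ 3" using t by (simp add: power_numeral_reduce)
  also have "\<dots> \<le> 1 / (real t)\<^sup>2" using t by (intro divide_left_mono power_increasing) auto
  finally show ?thesis .
qed

text \<open>A pull in a bad round is paid for by the indicator. In any other round \<open>a\<close>
  is pulled only while its counter is at most \<open>pull_bound a\<close>, and the 1 accounts for
  that pull.\<close>

lemma cnt_le_pull_bound:
  assumes a: "a \<in> {1..K}" and g: "0 < gap K D a" and c: "c \<in> {1..K}" "\<mu> c = best_mean K D"
    and \<omega>: "\<omega> \<in> space M"
  shows "t \<le> T \<Longrightarrow> real (cnt \<omega> t a) \<le> pull_bound a + 1 + (\<Sum>i = 1..t. indicator (bad a c i) \<omega>)"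
proof (induction t)
  case 0
  then show ?case using pull_bound_nonneg[of a] by simp
next
  case (Suc t)
  let ?N = "cnt \<omega> t" and ?I = "\<lambda>t. \<Sum>i = 1..t. indicator (bad a c i) \<omega> :: real"
  have I: "0 \<le> ?I t" by (intro sum_nonneg) auto
  show ?case
  proof (cases "pick \<omega> (Suc t) ?N = a")
    case False
    then have "cnt \<omega> (Suc t) a = ?N a" by (simp add: cnt_Suc)
    then show ?thesis using Suc by (simp split: split_indicator)
  next
    case True
    then have step: "cnt \<omega> (Suc t) a = ?N a + 1" by (simp add: cnt_Suc)
    show ?thesis
    proof (cases "\<omega> \<in> bad a c (Suc t)")
      case True
      then show ?thesis using Suc step by simp
    next
      case nb: False
      have "real (?N a) \<le> pull_bound a"
      proof (cases "Suc t \<le> K")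
        case True
        \<comment> \<open>During initialization the arm pulled has never been pulled before, so its
          counter is 0.\<close>
        then have "a = Suc t" using \<open>pick \<omega> (Suc t) ?N = a\<close> by (simp add: choose_arm_def)
        then show ?thesis using cnt_initial[of t \<omega> a] True pull_bound_nonneg[of a] by simp
      next
        case False
        then have Na: "1 \<le> ?N a" "?N a \<le> t" and Nc: "1 \<le> ?N c" "?N c \<le> t"
          using a c cnt_le cnt_pos by auto
        have ua: "S \<omega> a (?N a) / ?N a < \<mu> a + width (Suc t) (?N a)"
          and uc: "\<mu> c - width (Suc t) (?N c) < S \<omega> c (?N c) / ?N c"
          by (rule not_bad[OF \<omega> nb]; use Na Nc in simp)+
        have "idx \<omega> (Suc t) ?N c \<le> idx \<omega> (Suc t) ?N a"
          using pick_maximizer[of "Suc t" \<omega> ?N] False True c by auto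
        \<comment> \<open>The index of \<open>c\<close> exceeds the best mean, while that of
          \<open>a\<close> is below its own mean plus twice its width.\<close>
        then have "gap K D a \<le> 2 * width (Suc t) (?N a)"
          using ua uc c unfolding ucb_index_def gap_def by linarith
        then show ?thesis using g Na Suc.prems by (intro le_pull_bound) auto
      qed
      then show ?thesis using step I nb by simp
    qed
  qed
qed

text \<open>The 3 consists of the 1 in the pathwise bound and of 2 for the expected number of bad
  rounds.\<close>

lemma mean_cnt_le:
  assumes a: "a \<in> {1..K}" and g: "0 < gap K D a"
    and big: "2 / (min 1 (log b 2))\<^sup>2 \<le> L powr (1 / 4)" "2 * ln b \<le> L powr (1 / 4)"
  shows "mean_cnt a \<le> pull_bound a + 3"
proof -
  obtain c where c: "c \<in> {1..K}" "\<mu> c = best_mean K D" by (rule best_arm)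
  have ii: "integrable M (indicator (bad a c i) :: _ \<Rightarrow> real)" for i
    by (rule M.integrable_const_bound[where B = 1]) auto
  have "mean_cnt a \<le> (\<integral>\<omega>. pull_bound a + 1 + (\<Sum>i = 1..T. indicator (bad a c i) \<omega>) \<partial>M)"
    by (intro integral_mono integrable_cnt Bochner_Integration.integrable_add Bochner_Integration.integrable_sum
        ii cnt_le_pull_bound[OF a g c]) auto
  also have "\<dots> = pull_bound a + 1 + (\<Sum>i = 1..T. M.prob (bad a c i))"
    by (simp add: Bochner_Integration.integral_sum Bochner_Integration.integrable_sum ii M.prob_space
        sets.Int_space_eq2)
  also have "(\<Sum>i = 1..T. M.prob (bad a c i)) \<le> (\<Sum>i = 1..T. 1 / (real i)\<^sup>2)"
    by (intro sum_mono prob_bad a c big) auto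
  also have "\<dots> \<le> 2" by (rule sum_inverse_square_le)
  finally show ?thesis by simp
qed

section \<open>Small horizons and the final regret bound\<close>

lemma T_le:
  assumes "L powr (1 / 4) \<le> m" shows "real T \<le> b powr (m ^ 4)"
proof -
  have "L = (L powr (1 / 4)) ^ 4" using L_pos by (simp add: powr_powr flip: powr_realpow)
  also have "\<dots> \<le> m ^ 4" using assms by (intro power_mono) auto
  finally have "b powr L \<le> b powr (m ^ 4)" using b by (intro powr_mono) auto
  then show ?thesis using b T by simp
qed

lemma regret_le:
  assumes m: "m = max (2 / (min 1 (log b 2))\<^sup>2) (2 * ln b)"
  shows "expected_regret b \<epsilon> v u K T tie D
    \<le> (b powr (m ^ 4) + 5 * 36 powr ((1 + v) / v) + 3) *
      (\<Sum>a | a \<in> {1..K} \<and> gap K D a > 0. L powr (2.5 + 1 / v) / \<epsilon> * (u / gap K D a) powr (1 / v) + gap K D a)"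
proof -
  let ?G = "{a. a \<in> {1..K} \<and> gap K D a > 0}"
  let ?C = "b powr (m ^ 4) + 5 * 36 powr ((1 + v) / v) + 3"
  let ?x = "\<lambda>a. L powr (2.5 + 1 / v) / \<epsilon> * (u / gap K D a) powr (1 / v)"
  have "expected_regret b \<epsilon> v u K T tie D = (\<Sum>a\<in>?G. gap K D a * mean_cnt a)"
  proof (unfold regret_eq, rule sum.mono_neutral_right)
    show "\<forall>a\<in>{1..K} - ?G. gap K D a * mean_cnt a = 0"
      using gap_nonneg by (fastforce simp: not_less)
  qed auto
  also have "\<dots> \<le> (\<Sum>a\<in>?G. ?C * (?x a + gap K D a))"
  proof (rule sum_mono)
    fix a assume "a \<in> ?G"
    then have a: "a \<in> {1..K}" and g: "0 < gap K D a" by auto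
    have x0: "0 \<le> ?x a" using eps by simp
    show "gap K D a * mean_cnt a \<le> ?C * (?x a + gap K D a)"
    \<comment> \<open>Above the threshold \<open>m\<close> both growth conditions of
      \<open>mean_cnt_le\<close> hold; below it \<open>T\<close> is bounded by a constant.
      \<open>?C\<close> adds up the constants of the two cases.\<close>
    proof (cases "m \<le> L powr (1 / 4)")
      case True
      then have "gap K D a * mean_cnt a \<le> gap K D a * (pull_bound a + 3)"
        using g m a by (intro mult_left_mono mean_cnt_le) auto
      also have "\<dots> \<le> 5 * 36 powr ((1 + v) / v) * ?x a + 3 * gap K D a"
        using gap_mult_pull_bound[OF g] by (simp add: distrib_left)
      also have "\<dots> \<le> ?C * ?x a + ?C * gap K D a"
        using x0 g by (intro add_mono mult_right_mono) auto
      finally show ?thesis by (simp add: distrib_left)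
    next
      case False
      have "mean_cnt a \<le> (\<integral>\<omega>. real T \<partial>M)"
        by (intro integral_mono integrable_cnt) (auto simp: cnt_le)
      also have "\<dots> = real T" by (simp add: M.prob_space)
      also have "\<dots> \<le> b powr (m ^ 4)" using False by (intro T_le) simp
      also have "\<dots> \<le> ?C" by simp
      finally have "gap K D a * mean_cnt a \<le> gap K D a * ?C" using g by (intro mult_left_mono) auto
      also have "\<dots> \<le> ?C * (?x a + gap K D a)"
        unfolding mult.commute[of "gap K D a"] using x0 by (intro mult_left_mono) (auto intro: add_nonneg_nonneg)
      finally show ?thesis .
    qed
  qed
  also have "\<dots> = ?C * (\<Sum>a\<in>?G. ?x a + gap K D a)" by (rule sum_distrib_left[symmetric])
  finally show ?thesis .
qed

end

theorem theorem2:
  fixes b v :: real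
  assumes "1 < b" and "0 < v" and "v \<le> 1"
  shows "\<exists>C>0. \<forall>(u::real) (\<epsilon>::real) (K::nat) (T::nat) tie (D :: nat \<Rightarrow> real measure).
           0 < u \<longrightarrow> 0 < \<epsilon> \<longrightarrow> \<epsilon> \<le> 1 \<longrightarrow> 1 \<le> K \<longrightarrow> 2 \<le> T \<longrightarrow> tie_rule K tie \<longrightarrow>
           (\<forall>a\<in>{1..K}. heavy_tailed v u (D a)) \<longrightarrow>
           expected_regret b \<epsilon> v u K T tie D
             \<le> C * (\<Sum>a | a \<in> {1..K} \<and> gap K D a > 0.
                       log b (real T) powr (2.5 + 1 / v) / \<epsilon> * (u / gap K D a) powr (1 / v)
                       + gap K D a)"
proof -
  define m where "m = max (2 / (min 1 (log b 2))\<^sup>2) (2 * ln b)"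
  \<comment> \<open>This constant depends on \<open>b\<close> and \<open>v\<close> alone, so it can
    be chosen before all the other parameters.\<close>
  let ?C = "b powr (m ^ 4) + 5 * 36 powr ((1 + v) / v) + 3"
  have "dp_bandit b \<epsilon> v u K T tie D"
    if "0 < u" "0 < \<epsilon>" "\<epsilon> \<le> 1" "1 \<le> K" "2 \<le> T" "tie_rule K tie" "\<forall>a\<in>{1..K}. heavy_tailed v u (D a)"
    for u \<epsilon> K T tie D
    using that assms by unfold_locales auto
  note bound = dp_bandit.regret_le[OF this m_def]
  have "0 < ?C" by (intro add_nonneg_pos add_nonneg_nonneg) auto
  then show ?thesis by (intro exI[of _ ?C] conjI allI impI bound)
qed

end
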